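(* Let $n\ge1$. For any parametrization $\phi(t)=(t^{v_0},y_1(t),\ldots,y_n(t))\in\mathcal{P}_{(v_0,w_1,\ldots,w_n)}$ with semigroup $\Gamma$ and conductor $c$, $\phi(t)$ is $\mathcal{A}$-equivalent to $$(t^{v_0},j^{e_1}y_1(t),\ldots,j^{e_n}y_n(t)),\qquad\text{where } e_i=\max\{w_i,c-1\}.$$ In particular, $\phi(t)$ is $\mathcal{A}$-equivalent to $j^e\phi(t)$, where $e=\max\{e_1,\ldots,e_n\}$.
   Context: A parametrization is an analytic map-germ $\phi=(p_0,\ldots,p_n):(\mathbb{C},0)\to(\mathbb{C}^{n+1},0)$, always assumed primitive (not of the form $\psi(\tau(t))$ with $\mathrm{ord}_t\,\tau\ge2$) and non-degenerate (not $\mathcal{A}$-equivalent to a map-germ with an identically zero component). $\mathcal{A}$-equivalence of $\phi_1,\phi_2$: $\phi_2=\sigma\circ\phi_1\circ\rho^{-1}$ for some $(\rho,\sigma)\in\mathcal{A}=\mathrm{Diff}(\mathbb{C},0)\times\mathrm{Diff}(\mathbb{C}^{n+1},0)$. $j^kf$ is the Taylor polynomial of degree $k$ of $f$ at $0$. The value semigroup of $\phi$ is $\Gamma=\{\mathrm{ord}_t(g(\phi(t))) : g\in\mathbb{C}\{X,Y_1,\ldots,Y_n\},\ g(\phi(t))\neq 0\}$, a numerical semigroup; its conductor $c$ is the element $c\in\Gamma$ with $c-1\notin\Gamma$ and $z\in\Gamma$ for all integers $z\ge c$. For $1\le i\le n$, $\Gamma_i=\{\mathrm{ord}_t(h(p_0,\ldots,p_{i-1}))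 : h\in\mathbb{C}\{X,Y_1,\ldots,Y_{i-1}\},\ h(p_0,\ldots,p_{i-1})\ne 0\}$. $\mathcal{P}_{(v_0,w_1,\ldots,w_n)}$ is the set of parametrizations $\phi(t)=(t^{v_0},y_1(t),\ldots,y_n(t))$ such that $y_i(t)=t^{w_i}+(\text{terms of order}>w_i)$ and $w_i=\min(\Gamma\setminus\Gamma_i)$ for $1\le i\le n$, with $v_0<w_1<\cdots<w_n$ and $v_0=\min(\Gamma\setminus\{0\})$. *)

theory Defs
  imports "HOL-Complex_Analysis.Complex_Analysis"
begin

text \<open>
  Since the dimension varies within the definitions, a point of \<open>\<complex>\<^sup>m\<close> is a function
  \<open>x :: nat \<Rightarrow> complex\<close> of which only the coordinates \<open>x 0, \<dots>, x (m - 1)\<close> matter.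
  Germs at the origin are represented by total functions; every condition below depends
  only on their values near the origin.
\<close>

definition near_origin :: "nat \<Rightarrow> ((nat \<Rightarrow> complex) \<Rightarrow> bool) \<Rightarrow> bool" where
  "near_origin m P \<longleftrightarrow> (\<exists>r>0. \<forall>x. (\<forall>i<m. norm (x i) < r) \<longrightarrow> P x)"

definition multi_indices :: "nat \<Rightarrow> (nat \<Rightarrow> nat) set" where
  "multi_indices m = {\<alpha>. \<forall>i\<ge>m. \<alpha> i = 0}"

text \<open>
  Elements of the ring \<open>\<complex>{X\<^sub>0, \<dots>, X\<^sub>m\<^sub>-\<^sub>1}\<close> of convergent power series, viewed as function
  germs. They depend, near the origin, on the first \<open>m\<close> coordinates only.
\<close>

definition convergent_series :: "nat \<Rightarrow> ((nat \<Rightarrow> complex) \<Rightarrow> complex) set" where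
  "convergent_series m =
     {g. \<exists>a. near_origin m
        (\<lambda>x. ((\<lambda>\<alpha>. a \<alpha> * (\<Prod>i<m. x i ^ \<alpha> i)) has_sum g x) (multi_indices m))}"

text \<open>The order of a germ of one variable that is analytic at \<open>0\<close>; the zero germ has order \<open>\<infinity>\<close>.\<close>

definition ord0 :: "(complex \<Rightarrow> complex) \<Rightarrow> enat" where
  "ord0 f = (if \<forall>\<^sub>F t in nhds 0. f t = 0 then \<infinity> else enat (nat (zorder f 0)))"

definition jet :: "nat \<Rightarrow> (complex \<Rightarrow> complex) \<Rightarrow> complex \<Rightarrow> complex" where
  "jet k f t = (\<Sum>j\<le>k. (deriv ^^ j) f 0 / fact j * t ^ j)"

text \<open>Analytic map-germs \<open>(\<complex>,0) \<rightarrow> (\<complex>\<^sup>m,0)\<close>; the \<open>i\<close>-th component of \<open>\<phi>\<close> is \<open>\<lambda>t. \<phi> t i\<close>.\<close>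

definition curve_germ :: "nat \<Rightarrow> (complex \<Rightarrow> nat \<Rightarrow> complex) \<Rightarrow> bool" where
  "curve_germ m \<phi> \<longleftrightarrow> (\<forall>i<m. (\<lambda>t. \<phi> t i) analytic_on {0} \<and> \<phi> 0 i = 0)"

text \<open>\<open>\<rho> \<in> Diff(\<complex>,0)\<close> with inverse \<open>\<rho>'\<close>\<close>

definition inverse_germs1 :: "(complex \<Rightarrow> complex) \<Rightarrow> (complex \<Rightarrow> complex) \<Rightarrow> bool" where
  "inverse_germs1 \<rho> \<rho>' \<longleftrightarrow>
     \<rho> analytic_on {0} \<and> \<rho> 0 = 0 \<and> \<rho>' analytic_on {0} \<and> \<rho>' 0 = 0 \<and>
     (\<forall>\<^sub>F t in nhds 0. \<rho>' (\<rho> t) = t \<and> \<rho> (\<rho>' t) = t)"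

text \<open>Analytic map-germs \<open>(\<complex>\<^sup>m,0) \<rightarrow> (\<complex>\<^sup>m,0)\<close>, and the group \<open>Diff(\<complex>\<^sup>m,0)\<close>\<close>

definition analytic_self_germ :: "nat \<Rightarrow> ((nat \<Rightarrow> complex) \<Rightarrow> nat \<Rightarrow> complex) \<Rightarrow> bool" where
  "analytic_self_germ m \<sigma> \<longleftrightarrow>
     (\<forall>i<m. (\<lambda>x. \<sigma> x i) \<in> convergent_series m \<and> \<sigma> (\<lambda>_. 0) i = 0)"

definition Diff :: "nat \<Rightarrow> ((nat \<Rightarrow> complex) \<Rightarrow> nat \<Rightarrow> complex) set" where
  "Diff m = {\<sigma>. analytic_self_germ m \<sigma> \<and>
     (\<exists>\<sigma>'. analytic_self_germ m \<sigma>' \<and>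
        near_origin m (\<lambda>x. \<forall>i<m. \<sigma>' (\<sigma> x) i = x i \<and> \<sigma> (\<sigma>' x) i = x i))}"

text \<open>\<open>\<phi>\<^sub>2 = \<sigma> \<circ> \<phi>\<^sub>1 \<circ> \<rho>\<inverse>\<close> as germs\<close>

definition A_equivalent ::
  "nat \<Rightarrow> (complex \<Rightarrow> nat \<Rightarrow> complex) \<Rightarrow> (complex \<Rightarrow> nat \<Rightarrow> complex) \<Rightarrow> bool" where
  "A_equivalent m \<phi>\<^sub>1 \<phi>\<^sub>2 \<longleftrightarrow>
     (\<exists>\<rho> \<rho>' \<sigma>. inverse_germs1 \<rho> \<rho>' \<and> \<sigma> \<in> Diff m \<and>
        (\<forall>\<^sub>F t in nhds 0. \<forall>i<m. \<phi>\<^sub>2 t i = \<sigma> (\<phi>\<^sub>1 (\<rho>' t)) i))"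

definition primitive :: "nat \<Rightarrow> (complex \<Rightarrow> nat \<Rightarrow> complex) \<Rightarrow> bool" where
  "primitive m \<phi> \<longleftrightarrow>
     \<not> (\<exists>\<psi> \<tau>. curve_germ m \<psi> \<and> \<tau> analytic_on {0} \<and> ord0 \<tau> \<ge> 2 \<and>
          (\<forall>\<^sub>F t in nhds 0. \<forall>i<m. \<phi> t i = \<psi> (\<tau> t) i))"

definition nondegenerate :: "nat \<Rightarrow> (complex \<Rightarrow> nat \<Rightarrow> complex) \<Rightarrow> bool" where
  "nondegenerate m \<phi> \<longleftrightarrow>
     \<not> (\<exists>\<psi>. curve_germ m \<psi> \<and> A_equivalent m \<phi> \<psi> \<and>
          (\<exists>i<m. \<forall>\<^sub>F t in nhds 0. \<psi> t i = 0))"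

definition parametrization :: "nat \<Rightarrow> (complex \<Rightarrow> nat \<Rightarrow> complex) \<Rightarrow> bool" where
  "parametrization m \<phi> \<longleftrightarrow> curve_germ m \<phi> \<and> primitive m \<phi> \<and> nondegenerate m \<phi>"

text \<open>
  For \<open>\<phi> : (\<complex>,0) \<rightarrow> (\<complex>\<^sup>n\<^sup>+\<^sup>1,0)\<close>, the semigroup \<open>\<Gamma>\<close> is \<open>value_semigroup (n + 1) \<phi>\<close> and
  \<open>\<Gamma>\<^sub>i\<close> is \<open>value_semigroup i \<phi>\<close>, where only the components \<open>p\<^sub>0, \<dots>, p\<^sub>i\<^sub>-\<^sub>1\<close> enter.
\<close>

definition value_semigroup :: "nat \<Rightarrow> (complex \<Rightarrow> nat \<Rightarrow> complex) \<Rightarrow> nat set" where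
  "value_semigroup m \<phi> = {k. \<exists>g\<in>convergent_series m. ord0 (\<lambda>t. g (\<phi> t)) = enat k}"

definition is_conductor :: "nat set \<Rightarrow> nat \<Rightarrow> bool" where
  "is_conductor \<Gamma> c \<longleftrightarrow> c \<in> \<Gamma> \<and> int c - 1 \<notin> int ` \<Gamma> \<and> (\<forall>z\<ge>c. z \<in> \<Gamma>)"

definition is_min :: "nat \<Rightarrow> nat set \<Rightarrow> bool" where
  "is_min k S \<longleftrightarrow> k \<in> S \<and> (\<forall>l\<in>S. k \<le> l)"

text \<open>The set \<open>\<P>\<close> with indices \<open>(v\<^sub>0, w\<^sub>1, \<dots>, w\<^sub>n)\<close>; \<open>w\<close> is used at the indices \<open>1, \<dots>, n\<close> only.\<close>

definition param_class :: "nat \<Rightarrow> nat \<Rightarrow> (nat \<Rightarrow> nat) \<Rightarrow> (complex \<Rightarrow> nat \<Rightarrow> complex) set" where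
  "param_class n v\<^sub>0 w =
     {\<phi>. parametrization (n + 1) \<phi> \<and>
         (\<forall>\<^sub>F t in nhds 0. \<phi> t 0 = t ^ v\<^sub>0) \<and>
         (\<forall>i\<in>{1..n}. ord0 (\<lambda>t. \<phi> t i - t ^ w i) > enat (w i)) \<and>
         (\<forall>i\<in>{1..n}. is_min (w i) (value_semigroup (n + 1) \<phi> - value_semigroup i \<phi>)) \<and>
         is_min v\<^sub>0 (value_semigroup (n + 1) \<phi> - {0}) \<and>
         (\<forall>i\<in>{1..n}. v\<^sub>0 < w i) \<and> strict_mono_on {1..n} w}"

end

(* Write x = t^v for the first component. Since \<complex>{t} is a finite module over \<complex>{x}, Nakayama's
   lemma, applied to elements of the local ring of the curve with the orders c, ..., c + v - 1, shows that every
   germ of order at least c is g(\<phi>(t)) for some convergent g. In particular each remainder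
   y_i - j^{e_i} y_i equals g_i(\<phi>), and \<sigma>(x) = x - g(x) carries \<phi> to its truncation. As the remainder has
   order greater than w_i, and w_j is not in \<Gamma>_j, the linear part of g_i involves only the coordinates
   x_j with j > i; hence the Jacobian of \<sigma> at 0 is unipotent and \<sigma> is invertible.
   The inverse is found by a fixed point iteration in the Banach algebra of power series with
   absolutely summable coefficients on a polydisc. *)
theory Submission
  imports Defs
begin

unbundle no vec_syntax

section \<open>Power series on polydiscs\<close>

text \<open>The two numbers under the maximum answer two separate obstacles. Order at least
  \<open>c\<close> makes a remainder a pullback; order above \<open>w i\<close> keeps the change of
  coordinates invertible, since a remainder that contained the leading term \<open>t ^ w i\<close>
  could force the coordinate \<open>x i\<close> itself into \<open>g i\<close>. Neither number
  dominates in general: for (t^3, t^4, t^5) the conductor is 3, while w = (4, 5), and cutting at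
  degree 2 would destroy the curve. The norm is the weighted sum of absolute values of the
  coefficients rather than a supremum: products and substitutions then obey simple inequalities
  without loss of radius, and a norm-convergent sum of series is again a series, so holomorphic
  functions of several variables never enter. The linear part of g is nilpotent but need not be
  small, so the iteration contracts only in a rescaled norm. Only the target is transformed; the
  parameter t stays fixed throughout.\<close>

definition mon :: "nat \<Rightarrow> (nat \<Rightarrow> nat) \<Rightarrow> (nat \<Rightarrow> complex) \<Rightarrow> complex" where
  "mon m \<alpha> x = (\<Prod>i<m. x i ^ \<alpha> i)"

definition deg :: "nat \<Rightarrow> (nat \<Rightarrow> nat) \<Rightarrow> nat" where
  "deg m \<alpha> = (\<Sum>i<m. \<alpha> i)"

lemma mon_0 [simp]: "mon 0 \<alpha> x = 1" and mon_zero [simp]: "mon m (\<lambda>_. 0) x = 1"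
  and mon_Suc: "mon (Suc m) \<alpha> x = mon m \<alpha> x * x m ^ \<alpha> m"
  by (simp_all add: mon_def)

lemma deg_0 [simp]: "deg 0 \<alpha> = 0" and deg_zero [simp]: "deg m (\<lambda>_. 0) = 0"
  and deg_Suc: "deg (Suc m) \<alpha> = deg m \<alpha> + \<alpha> m"
  by (simp_all add: deg_def)

abbreviation polydisc :: "nat \<Rightarrow> real \<Rightarrow> (nat \<Rightarrow> complex) \<Rightarrow> bool" where
  "polydisc m r x \<equiv> \<forall>i<m. norm (x i) \<le> r"

text \<open>The bound \<open>M\<close> on the weighted l^1 norm is carried along explicitly, so that
  estimates become inequalities between bounds. The polydisc is closed because a germ with bound
  \<open>s\<close> takes values of modulus at most \<open>s\<close>, and these must be admissible
  arguments of a series of radius \<open>s\<close>.\<close>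

definition series_bound ::
  "nat \<Rightarrow> real \<Rightarrow> real \<Rightarrow> ((nat \<Rightarrow> nat) \<Rightarrow> complex) \<Rightarrow> ((nat \<Rightarrow> complex) \<Rightarrow> complex) \<Rightarrow> bool" where
  "series_bound m r M a f \<longleftrightarrow>
     (\<lambda>\<alpha>. norm (a \<alpha>) * r ^ deg m \<alpha>) summable_on multi_indices m \<and>
     (\<Sum>\<^sub>\<infinity>\<alpha>\<in>multi_indices m. norm (a \<alpha>) * r ^ deg m \<alpha>) \<le> M \<and>
     (\<forall>x. polydisc m r x \<longrightarrow> ((\<lambda>\<alpha>. a \<alpha> * mon m \<alpha> x) has_sum f x) (multi_indices m))"

definition majorized :: "nat \<Rightarrow> real \<Rightarrow> real \<Rightarrow> ((nat \<Rightarrow> complex) \<Rightarrow> complex) \<Rightarrow> bool" where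
  "majorized m r M f \<longleftrightarrow> (\<exists>a. series_bound m r M a f)"

lemma norm_mon_le:
  assumes "polydisc m r x"
  shows "norm (mon m \<alpha> x) \<le> r ^ deg m \<alpha>"
proof -
  have "norm (mon m \<alpha> x) = (\<Prod>i<m. norm (x i) ^ \<alpha> i)"
    by (simp add: mon_def prod_norm[symmetric] norm_power)
  also have "\<dots> \<le> (\<Prod>i<m. r ^ \<alpha> i)"
    by (rule prod_mono) (use assms in \<open>auto intro!: power_mono\<close>)
  finally show ?thesis by (simp add: deg_def power_sum)
qed

lemma series_boundI:
  assumes "(\<lambda>\<alpha>. norm (a \<alpha>) * r ^ deg m \<alpha>) summable_on multi_indices m"
    and "(\<Sum>\<^sub>\<infinity>\<alpha>\<in>multi_indices m. norm (a \<alpha>) * r ^ deg m \<alpha>) \<le> M"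
    and "\<And>x. polydisc m r x \<Longrightarrow> ((\<lambda>\<alpha>. a \<alpha> * mon m \<alpha> x) has_sum f x) (multi_indices m)"
  shows "series_bound m r M a f"
  using assms by (auto simp: series_bound_def)

lemma majorized_norm_le:
  assumes "majorized m r M f" "polydisc m r x"
  shows "norm (f x) \<le> M"
proof -
  obtain a where a: "series_bound m r M a f" using assms by (auto simp: majorized_def)
  have "norm (f x) \<le> (\<Sum>\<^sub>\<infinity>\<alpha>\<in>multi_indices m. norm (a \<alpha>) * r ^ deg m \<alpha>)"
    by (rule norm_infsum_le[where X="multi_indices m" and f="\<lambda>\<alpha>. a \<alpha> * mon m \<alpha> x"
          and g="\<lambda>\<alpha>. norm (a \<alpha>) * r ^ deg m \<alpha>"])
       (use a assms(2) norm_mon_le[OF assms(2)] in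
         \<open>auto simp: series_bound_def norm_mult intro!: mult_left_mono\<close>)
  with a show ?thesis by (auto simp: series_bound_def)
qed

lemma majorized_mono:
  assumes "majorized m r M f" "M \<le> M'"
  shows "majorized m r M' f"
  using assms by (force simp: majorized_def series_bound_def)

text \<open>Completeness of the algebra, in a form that also serves finite sums, products,
  composition and the limit of the Picard iterates. The nonnegative family \<open>P\<close> on pairs
  of summation index and exponent is summable, so the coefficients of \<open>F\<close> are obtained
  by summing over the index first, and the bounds add up.\<close>

lemma majorized_infsum:
  fixes h :: "'k \<Rightarrow> (nat \<Rightarrow> complex) \<Rightarrow> complex"
  assumes r: "r > 0"
    and h: "\<And>k. k \<in> I \<Longrightarrow> majorized m r (N k) (h k)"
    and N: "N summable_on I" "infsum N I \<le> M"
    and F: "\<And>x. polydisc m r x \<Longrightarrow> ((\<lambda>k. h k x) has_sum F x) I"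
  shows "majorized m r M F"
proof -
  let ?A = "multi_indices m"
  obtain a where a: "\<And>k. k \<in> I \<Longrightarrow> series_bound m r (N k) (a k) (h k)"
    using h unfolding majorized_def by metis
  define P where "P = (\<lambda>(k, \<alpha>). norm (a k \<alpha>) * r ^ deg m \<alpha>)"
  define T where "T k = (\<Sum>\<^sub>\<infinity>\<alpha>\<in>?A. norm (a k \<alpha>) * r ^ deg m \<alpha>)" for k
  have P0: "P y \<ge> 0" for y using r by (auto simp: P_def split: prod.splits)
  have T: "((\<lambda>\<alpha>. P (k, \<alpha>)) has_sum T k) ?A" "T k \<le> N k" if "k \<in> I" for k
    using a[OF that] by (auto simp: series_bound_def P_def T_def)
  have T0: "T k \<ge> 0" for k unfolding T_def using r by (intro infsum_nonneg) auto
  have Ts: "T summable_on I"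
    by (rule summable_on_comparison_test[OF N(1)]) (use T T0 in auto)
  have Ps: "P summable_on I \<times> ?A"
    by (rule summable_on_SigmaI[where g=T]) (use T Ts P0 in auto)
  have Psw: "(\<lambda>(\<alpha>, k). P (k, \<alpha>)) summable_on ?A \<times> I"
    using Ps by (subst (asm) summable_on_swap) auto
  have Pk: "(\<lambda>k. P (k, \<alpha>)) summable_on I" if "\<alpha> \<in> ?A" for \<alpha>
    using summable_on_SigmaD1[OF Psw that] .
  have tot: "infsum P (I \<times> ?A) = infsum T I"
  proof -
    have "(P has_sum infsum T I) (I \<times> ?A)"
      by (rule has_sum_SigmaI[where g=T]) (use T Ts Ps in auto)
    thus ?thesis by (rule infsumI)
  qed
  define b where "b \<alpha> = (\<Sum>\<^sub>\<infinity>k\<in>I. a k \<alpha>)" for \<alpha>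
  define U where "U \<alpha> = (\<Sum>\<^sub>\<infinity>k\<in>I. P (k, \<alpha>))" for \<alpha>
  have U: "(U has_sum infsum T I) ?A"
  proof (rule has_sum_SigmaD[where f="\<lambda>(\<alpha>, k). P (k, \<alpha>)"])
    show "((\<lambda>(\<alpha>, k). P (k, \<alpha>)) has_sum infsum T I) (?A \<times> I)"
      using Ps tot has_sum_infsum has_sum_swap by metis
    show "((\<lambda>y. case (\<alpha>, y) of (\<alpha>, k) \<Rightarrow> P (k, \<alpha>)) has_sum U \<alpha>) I" if "\<alpha> \<in> ?A" for \<alpha>
      using Pk[OF that] by (simp add: U_def)
  qed
  have as: "(\<lambda>k. norm (a k \<alpha>)) summable_on I" if "\<alpha> \<in> ?A" for \<alpha>
  proof -
    have "(\<lambda>k. inverse (r ^ deg m \<alpha>) * P (k, \<alpha>)) summable_on I"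
      using Pk[OF that] by (rule summable_on_cmult_right)
    thus ?thesis using r by (simp add: P_def field_simps)
  qed
  have bsum: "((\<lambda>k. a k \<alpha>) has_sum b \<alpha>) I" if "\<alpha> \<in> ?A" for \<alpha>
    unfolding b_def using Infinite_Sum.abs_summable_summable[OF as[OF that]] by simp
  have bU: "norm (b \<alpha>) * r ^ deg m \<alpha> \<le> U \<alpha>" if "\<alpha> \<in> ?A" for \<alpha>
  proof -
    have "norm (b \<alpha> * of_real (r ^ deg m \<alpha>)) \<le> U \<alpha>"
    proof (rule norm_infsum_le)
      show "((\<lambda>k. a k \<alpha> * of_real (r ^ deg m \<alpha>)) has_sum b \<alpha> * of_real (r ^ deg m \<alpha>)) I"
        by (rule has_sum_cmult_left) (rule bsum[OF that])
      show "((\<lambda>k. P (k, \<alpha>)) has_sum U \<alpha>) I" using Pk[OF that] by (simp add: U_def)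
    qed (use r in \<open>auto simp: P_def norm_mult norm_power\<close>)
    thus ?thesis using r by (simp add: norm_mult norm_power)
  qed
  have "series_bound m r M b F"
  proof (rule series_boundI)
    show s: "(\<lambda>\<alpha>. norm (b \<alpha>) * r ^ deg m \<alpha>) summable_on ?A"
      by (rule summable_on_comparison_test[of U]) (use U bU r in \<open>auto intro: has_sum_imp_summable\<close>)
    have "(\<Sum>\<^sub>\<infinity>\<alpha>\<in>?A. norm (b \<alpha>) * r ^ deg m \<alpha>) \<le> infsum U ?A"
      by (rule infsum_mono) (use s U bU in \<open>auto intro: has_sum_imp_summable\<close>)
    also have "\<dots> = infsum T I" using U by (rule infsumI)
    also have "\<dots> \<le> infsum N I" by (rule infsum_mono) (use Ts N T in auto)
    finally show "(\<Sum>\<^sub>\<infinity>\<alpha>\<in>?A. norm (b \<alpha>) * r ^ deg m \<alpha>) \<le> M" using N by simp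
    fix x :: "nat \<Rightarrow> complex" assume x: "polydisc m r x"
    \<comment> \<open>The double series of values is dominated by \<open>P\<close>, hence may be
      summed in either order: exponents first gives \<open>h k x\<close>, the index first gives the
      series with coefficients \<open>b\<close>.\<close>
    define Q where "Q = (\<lambda>(k, \<alpha>). a k \<alpha> * mon m \<alpha> x)"
    have "(\<lambda>y. norm (Q y)) summable_on I \<times> ?A"
      by (rule Infinite_Sum.abs_summable_on_comparison_test'[OF Ps])
         (use norm_mon_le[OF x] in \<open>auto simp: P_def Q_def norm_mult intro!: mult_left_mono\<close>)
    then obtain S where S: "(Q has_sum S) (I \<times> ?A)"
      using Infinite_Sum.abs_summable_summable summable_on_def by blast
    have "((\<lambda>k. h k x) has_sum S) I"
      by (rule has_sum_SigmaD[OF S]) (use a x in \<open>auto simp: Q_def series_bound_def\<close>)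
    hence [simp]: "S = F x" using F[OF x] has_sum_unique by blast
    show "((\<lambda>\<alpha>. b \<alpha> * mon m \<alpha> x) has_sum F x) ?A"
    proof (rule has_sum_SigmaD[where f="\<lambda>(\<alpha>, k). Q (k, \<alpha>)"])
      show "((\<lambda>(\<alpha>, k). Q (k, \<alpha>)) has_sum F x) (?A \<times> I)"
        using S by (subst (asm) has_sum_swap) simp
    qed (auto simp: Q_def intro!: has_sum_cmult_left bsum)
  qed
  thus ?thesis by (auto simp: majorized_def)
qed

section \<open>Algebra operations and substitution for majorized germs\<close>

lemma majorized_sum:
  assumes "r > 0" "finite I" "\<And>k. k \<in> I \<Longrightarrow> majorized m r (N k) (h k)" "sum N I \<le> M"
  shows "majorized m r M (\<lambda>x. \<Sum>k\<in>I. h k x)"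
  by (rule majorized_infsum[where N=N and h=h and I=I]) (use assms in auto)

lemma zero_in_multi_indices [simp]: "(\<lambda>_. 0) \<in> multi_indices m"
  by (simp add: multi_indices_def)

lemma majorized_const:
  assumes "norm c \<le> M"
  shows "majorized m r M (\<lambda>_. c)"
proof -
  let ?a = "\<lambda>\<alpha>. if \<alpha> = (\<lambda>_. 0) then c else 0"
  have "((\<lambda>\<alpha>. norm (?a \<alpha>) * r ^ deg m \<alpha>) has_sum norm c) (multi_indices m)"
    by (rule has_sum_finite_neutralI[where B="{\<lambda>_. 0}"]) auto
  moreover have "((\<lambda>\<alpha>. ?a \<alpha> * mon m \<alpha> x) has_sum c) (multi_indices m)" for x
    by (rule has_sum_finite_neutralI[where B="{\<lambda>_. 0}"]) auto
  ultimately have "series_bound m r M ?a (\<lambda>_. c)"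
    using assms unfolding series_bound_def by (metis (no_types, lifting) has_sum_iff)
  thus ?thesis by (auto simp: majorized_def)
qed

lemma mon_upd:
  assumes "i < m"
  shows "mon m (\<alpha>(i := Suc (\<alpha> i))) x = x i * mon m \<alpha> x"
proof -
  have "mon m (\<alpha>(i := Suc (\<alpha> i))) x = x i ^ Suc (\<alpha> i) * (\<Prod>j\<in>{..<m}-{i}. x j ^ \<alpha> j)"
    unfolding mon_def using assms by (subst prod.remove[of _ i]) auto
  also have "\<dots> = x i * mon m \<alpha> x"
    unfolding mon_def using assms by (subst (2) prod.remove[of _ i]) auto
  finally show ?thesis .
qed

lemma deg_upd:
  assumes "i < m"
  shows "deg m (\<alpha>(i := Suc (\<alpha> i))) = Suc (deg m \<alpha>)"
  using assms sum.remove[of "{..<m}" i "\<alpha>(i := Suc (\<alpha> i))"] sum.remove[of "{..<m}" i \<alpha>] by (simp add: deg_def)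

text \<open>Multiplication by the i-th coordinate shifts exponents injectively onto the
  multi-indices with nonzero i-th entry; outside this image \<open>g\<close> vanishes by
  hypothesis.\<close>

lemma has_sum_multi_indices_shift:
  fixes g :: "(nat \<Rightarrow> nat) \<Rightarrow> 'a :: {ab_group_add, topological_comm_monoid_add}"
  assumes i: "i < m" and g: "((\<lambda>\<alpha>. g (\<alpha>(i := Suc (\<alpha> i)))) has_sum s) (multi_indices m)"
    and g0: "\<And>\<gamma>. \<gamma> i = 0 \<Longrightarrow> g \<gamma> = 0"
  shows "(g has_sum s) (multi_indices m)"
proof -
  let ?A = "multi_indices m"
  define up where "up \<alpha> = \<alpha>(i := Suc (\<alpha> i))" for \<alpha> :: "nat \<Rightarrow> nat"
  have inj: "inj_on up ?A"
    by (rule inj_on_inverseI[where g="\<lambda>\<gamma>. \<gamma>(i := \<gamma> i - 1)"]) (auto simp: up_def)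
  have upA: "up ` ?A = {\<gamma>\<in>?A. \<gamma> i \<noteq> 0}"
  proof (intro equalityI subsetI)
    fix \<gamma> assume "\<gamma> \<in> {\<gamma>\<in>?A. \<gamma> i \<noteq> 0}"
    hence "\<gamma> = up (\<gamma>(i := \<gamma> i - 1))" "\<gamma>(i := \<gamma> i - 1) \<in> ?A"
      by (auto simp: up_def multi_indices_def)
    thus "\<gamma> \<in> up ` ?A" by blast
  qed (use i in \<open>auto simp: up_def multi_indices_def\<close>)
  have "(g has_sum s) (up ` ?A)"
    using g by (subst has_sum_reindex[OF inj]) (simp add: o_def up_def)
  thus ?thesis
    by (subst (asm) has_sum_cong_neutral[where T="?A" and g=g]) (use g0 upA in auto)
qed

lemma majorized_coord_mult:
  assumes r: "r > 0" and f: "majorized m r M f" and i: "i < m"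
  shows "majorized m r (r * M) (\<lambda>x. x i * f x)"
proof -
  let ?A = "multi_indices m"
  obtain a where a: "series_bound m r M a f" using f by (auto simp: majorized_def)
  define up where "up \<alpha> = \<alpha>(i := Suc (\<alpha> i))" for \<alpha> :: "nat \<Rightarrow> nat"
  define b where "b \<gamma> = (if \<gamma> i = 0 then 0 else a (\<gamma>(i := \<gamma> i - 1)))" for \<gamma>
  have bup: "b (up \<alpha>) = a \<alpha>" for \<alpha> by (simp add: b_def up_def)
  note shift = has_sum_multi_indices_shift[OF i]
  have s: "((\<lambda>\<alpha>. norm (a \<alpha>) * r ^ deg m \<alpha>) has_sum (\<Sum>\<^sub>\<infinity>\<alpha>\<in>?A. norm (a \<alpha>) * r ^ deg m \<alpha>)) ?A"
    using a by (auto simp: series_bound_def)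
  have "((\<lambda>\<gamma>. norm (b \<gamma>) * r ^ deg m \<gamma>) has_sum r * (\<Sum>\<^sub>\<infinity>\<alpha>\<in>?A. norm (a \<alpha>) * r ^ deg m \<alpha>)) ?A"
    by (rule shift) (use has_sum_cmult_right[OF s, of r] i in
        \<open>auto simp: bup[unfolded up_def] deg_upd mult_ac b_def[of "_ :: nat \<Rightarrow> nat"]\<close>)
  moreover have "((\<lambda>\<gamma>. b \<gamma> * mon m \<gamma> x) has_sum x i * f x) ?A" if "polydisc m r x" for x
  proof (rule shift)
    have "((\<lambda>\<alpha>. a \<alpha> * mon m \<alpha> x) has_sum f x) ?A" using a that by (auto simp: series_bound_def)
    from has_sum_cmult_right[OF this, of "x i"]
    show "((\<lambda>\<alpha>. b (\<alpha>(i := Suc (\<alpha> i))) * mon m (\<alpha>(i := Suc (\<alpha> i))) x) has_sum x i * f x) ?A"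
      using i by (simp add: bup[unfolded up_def] mon_upd mult_ac)
  qed (simp add: b_def)
  moreover have "r * (\<Sum>\<^sub>\<infinity>\<alpha>\<in>?A. norm (a \<alpha>) * r ^ deg m \<alpha>) \<le> r * M"
    using a r by (auto simp: series_bound_def)
  ultimately have "series_bound m r (r * M) b (\<lambda>x. x i * f x)"
    unfolding series_bound_def by (metis (no_types, lifting) has_sum_iff)
  thus ?thesis by (auto simp: majorized_def)
qed

lemma majorized_coord:
  assumes "r > 0" "i < m"
  shows "majorized m r r (\<lambda>x. x i)"
  using majorized_coord_mult[OF assms(1) majorized_const[of 1 1] assms(2)] by simp

lemma majorized_cmult:
  assumes "r > 0" "majorized m r M f" 
  shows "majorized m r (norm c * M) (\<lambda>x. c * f x)"
proof -
  obtain a where a: "series_bound m r M a f" using assms by (auto simp: majorized_def)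
  have "series_bound m r (norm c * M) (\<lambda>\<alpha>. c * a \<alpha>) (\<lambda>x. c * f x)"
    using a unfolding series_bound_def
    by (auto simp: norm_mult mult.assoc infsum_cmult_right' 
        intro!: summable_on_cmult_right has_sum_cmult_right mult_left_mono)
  thus ?thesis by (auto simp: majorized_def)
qed

lemma majorized_coord_power_mult:
  assumes "r > 0" "majorized m r M f" "i < m"
  shows "majorized m r (r ^ k * M) (\<lambda>x. x i ^ k * f x)"
proof (induction k)
  case (Suc k)
  show ?case using majorized_coord_mult[OF assms(1) Suc assms(3)] by (simp add: mult_ac)
qed (use assms in simp)

lemma majorized_mon_mult:
  assumes "r > 0" "majorized m r M f"
  shows "majorized m r (r ^ deg m \<alpha> * M) (\<lambda>x. mon m \<alpha> x * f x)"
proof -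
  \<comment> \<open>The induction runs over the number \<open>k\<close> of variables entering the
    monomial, while the ambient dimension \<open>m\<close> stays fixed.\<close>
  have "k \<le> m \<Longrightarrow> majorized m r (r ^ deg k \<alpha> * M) (\<lambda>x. mon k \<alpha> x * f x)" for k
  proof (induction k)
    case (Suc k)
    from majorized_coord_power_mult[OF assms(1) Suc.IH, of k "\<alpha> k"] Suc.prems
    show ?case by (simp add: power_add mult_ac mon_Suc deg_Suc)
  qed (use assms in simp)
  thus ?thesis by simp
qed

lemma majorized_nonneg:
  assumes "r > 0" "majorized m r M f"
  shows "M \<ge> 0"
  using majorized_norm_le[OF assms(2), of "\<lambda>_. 0"] assms(1)
  by (smt (verit) norm_ge_zero norm_zero)

text \<open>Expanding only the first factor turns the product into a sum of monomial multiples of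
  \<open>g\<close>, each with a known bound, so no Cauchy product over multi-indices has to be
  formed.\<close>

lemma majorized_mult:
  assumes r: "r > 0" and f: "majorized m r M f" and g: "majorized m r N g"
  shows "majorized m r (M * N) (\<lambda>x. f x * g x)"
proof -
  obtain a where a: "series_bound m r M a f" using f by (auto simp: majorized_def)
  show ?thesis
  proof (rule majorized_infsum[where I="multi_indices m" and h="\<lambda>\<alpha> x. a \<alpha> * (mon m \<alpha> x * g x)"
        and N="\<lambda>\<alpha>. norm (a \<alpha>) * (r ^ deg m \<alpha> * N)"])
    show "majorized m r (cmod (a \<alpha>) * (r ^ deg m \<alpha> * N)) (\<lambda>x. a \<alpha> * (mon m \<alpha> x * g x))" for \<alpha>
      by (intro majorized_cmult majorized_mon_mult r g)
    show "(\<lambda>\<alpha>. cmod (a \<alpha>) * (r ^ deg m \<alpha> * N)) summable_on multi_indices m"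
      using a summable_on_cmult_left unfolding series_bound_def
      by (simp add: mult.assoc[symmetric] summable_on_cmult_left)
    show "(\<Sum>\<^sub>\<infinity>\<alpha>\<in>multi_indices m. cmod (a \<alpha>) * (r ^ deg m \<alpha> * N)) \<le> M * N"
      using a majorized_nonneg[OF r g] unfolding series_bound_def
      by (simp add: mult.assoc[symmetric] infsum_cmult_left' mult_right_mono)
    show "((\<lambda>\<alpha>. a \<alpha> * (mon m \<alpha> x * g x)) has_sum f x * g x) (multi_indices m)" if "polydisc m r x" for x
    proof -
      have "((\<lambda>\<alpha>. a \<alpha> * mon m \<alpha> x) has_sum f x) (multi_indices m)"
        using a that by (auto simp: series_bound_def)
      from has_sum_cmult_left[OF this, of "g x"] show ?thesis by (simp only: mult.assoc)
    qed
  qed (rule r)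
qed

lemma majorized_add:
  assumes "r > 0" "majorized m r M f" "majorized m r N g"
  shows "majorized m r (M + N) (\<lambda>x. f x + g x)"
  using majorized_sum[of r "{True, False}" m "\<lambda>b. if b then M else N" "\<lambda>b. if b then f else g" "M + N"] assms 
  by simp

lemma majorized_diff:
  assumes "r > 0" "majorized m r M f" "majorized m r N g"
  shows "majorized m r (M + N) (\<lambda>x. f x - g x)"
  using majorized_add[OF assms(1,2) majorized_cmult[OF assms(1,3), of "-1"]] by simp

lemma majorized_power:
  assumes "r > 0" "majorized m r M f"
  shows "majorized m r (M ^ k) (\<lambda>x. f x ^ k)"
  by (induction k) (auto intro!: majorized_const majorized_mult assms)

lemma majorized_prod_power:
  assumes "r > 0" "\<And>i. i < m \<Longrightarrow> majorized k r s (\<lambda>x. \<tau> x i)"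
  shows "majorized k r (s ^ deg m \<alpha>) (\<lambda>x. mon m \<alpha> (\<tau> x))"
  using assms(2)
proof (induction m)
  case (Suc m)
  thus ?case using majorized_mult[OF assms(1) Suc.IH majorized_power[OF assms(1) Suc.prems[of m]]]
    by (simp add: power_add mon_Suc deg_Suc)
qed (auto intro!: majorized_const)

text \<open>The radius of the outer series equals the norm bound of the inner germs: by
  submultiplicativity a monomial in the \<open>\<tau> x i\<close> has norm at most
  \<open>s ^ deg m \<alpha>\<close>, which is exactly the weight in the norm of
  \<open>g\<close>.\<close>

lemma majorized_compose:
  assumes r: "r > 0" and g: "majorized m s M g"
    and \<tau>: "\<And>i. i < m \<Longrightarrow> majorized k r s (\<lambda>x. \<tau> x i)"
  shows "majorized k r M (\<lambda>x. g (\<tau> x))"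
proof -
  obtain a where a: "series_bound m s M a g" using g by (auto simp: majorized_def)
  show ?thesis
  proof (rule majorized_infsum[where I="multi_indices m" and h="\<lambda>\<alpha> x. a \<alpha> * mon m \<alpha> (\<tau> x)"
        and N="\<lambda>\<alpha>. norm (a \<alpha>) * s ^ deg m \<alpha>"])
    show "majorized k r (cmod (a \<alpha>) * s ^ deg m \<alpha>) (\<lambda>x. a \<alpha> * mon m \<alpha> (\<tau> x))" for \<alpha>
      by (intro majorized_cmult majorized_prod_power r \<tau>)
    show "((\<lambda>\<alpha>. a \<alpha> * mon m \<alpha> (\<tau> x)) has_sum g (\<tau> x)) (multi_indices m)" if "polydisc k r x" for x
      using a majorized_norm_le[OF \<tau> that] by (auto simp: series_bound_def)
  qed (use a r in \<open>auto simp: series_bound_def\<close>)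
qed

text \<open>Substitution of the identity, whose coordinates have norm \<open>s\<close> on the
  smaller polydisc and are therefore admissible for radius \<open>r\<close>.\<close>

lemma majorized_shrink:
  assumes "0 < s" "s \<le> r" "majorized m r M f"
  shows "majorized m s M f"
  using majorized_compose[OF assms(1,3), of m "\<lambda>x. x"] majorized_mono[OF majorized_coord[OF assms(1)] assms(2)]
  by simp

text \<open>Summation over multi-indices is unconditional, hence absolute for complex terms.
  Evaluating at the single point with all coordinates \<open>r/2\<close> thus yields a finite
  weighted norm of radius \<open>r/2\<close>.\<close>

lemma convergent_series_iff_majorized:
  "g \<in> convergent_series m \<longleftrightarrow> (\<exists>r>0. \<exists>M. majorized m r M g)"
proof
  assume "g \<in> convergent_series m"
  then obtain a r where r: "r > 0"
    and g: "\<And>x. (\<forall>i<m. norm (x i) < r) \<Longrightarrow> ((\<lambda>\<alpha>. a \<alpha> * mon m \<alpha> x) has_sum g x) (multi_indices m)"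
    by (auto simp: convergent_series_def near_origin_def mon_def)
  have "((\<lambda>\<alpha>. a \<alpha> * mon m \<alpha> (\<lambda>_. of_real (r/2))) has_sum g (\<lambda>_. of_real (r/2))) (multi_indices m)"
    by (rule g) (use r in auto)
  hence "(\<lambda>\<alpha>. norm (a \<alpha> * mon m \<alpha> (\<lambda>_. of_real (r/2)))) summable_on (multi_indices m)"
    using summable_on_iff_abs_summable_on_complex has_sum_imp_summable by metis
  moreover have "norm (a \<alpha> * mon m \<alpha> (\<lambda>_. of_real (r/2))) = norm (a \<alpha>) * (r/2) ^ deg m \<alpha>" for \<alpha>
    using r by (simp only: mon_def deg_def norm_mult prod_norm[symmetric] norm_power power_sum) simp
  ultimately have "\<exists>M. majorized m (r/2) M g"
    unfolding majorized_def series_bound_def using g r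
    by (intro exI[of _ "(\<Sum>\<^sub>\<infinity>\<alpha>\<in>multi_indices m. norm (a \<alpha>) * (r/2) ^ deg m \<alpha>)"] exI[of _ a] conjI allI impI)
       (auto simp: order.strict_trans1[of _ "r/2" r])
  thus "\<exists>r>0. \<exists>M. majorized m r M g" using r by (intro exI[of _ "r/2"]) auto
next
  assume "\<exists>r>0. \<exists>M. majorized m r M g"
  then obtain r M a where r: "r > 0" and a: "series_bound m r M a g"
    by (auto simp: majorized_def)
  have "((\<lambda>\<alpha>. a \<alpha> * (\<Prod>i<m. x i ^ \<alpha> i)) has_sum g x) (multi_indices m)"
    if "\<forall>i<m. norm (x i) < r" for x
    using a that by (simp add: series_bound_def mon_def[symmetric] less_imp_le)
  thus "g \<in> convergent_series m"
    unfolding convergent_series_def near_origin_def using r by blast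
qed

section \<open>Local inversion\<close>

lemma has_sum_diff:
  fixes f g :: "'a \<Rightarrow> 'b :: real_normed_vector"
  assumes "(f has_sum s) A" "(g has_sum t) A"
  shows "((\<lambda>x. f x - g x) has_sum s - t) A"
  using has_sum_add[OF assms(1), of "\<lambda>x. - g x" "- t"] assms(2) by (simp add: has_sum_uminus)

section \<open>Lipschitz estimates and the splitting off of the linear part\<close>

lemma majorized_mult_diff:
  assumes r: "r > 0"
    and "majorized k r A f" "majorized k r E (\<lambda>x. g x - g' x)"
    and "majorized k r D (\<lambda>x. f x - f' x)" "majorized k r B g'"
    and "A * E + D * B \<le> M"
  shows "majorized k r M (\<lambda>x. f x * g x - f' x * g' x)"
proof -
  have "majorized k r (A * E + D * B) (\<lambda>x. f x * (g x - g' x) + (f x - f' x) * g' x)"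
    by (intro majorized_add majorized_mult assms)
  thus ?thesis using majorized_mono[OF _ assms(6)] by (simp add: algebra_simps)
qed

text \<open>The bound is n d s^(n-1), as for a derivative; writing it with \<open>d / s\<close>
  avoids a subtraction in the exponent at \<open>n = 0\<close> and makes the bounds for products of
  powers add up.\<close>

lemma majorized_power_diff:
  assumes r: "r > 0" and s: "s > 0"
    and "majorized k r s f" "majorized k r s f'" "majorized k r d (\<lambda>x. f x - f' x)"
  shows "majorized k r (d / s * n * s ^ n) (\<lambda>x. f x ^ n - f' x ^ n)"
proof (induction n)
  case (Suc n)
  show ?case unfolding power_Suc
    by (rule majorized_mult_diff[OF r assms(3) Suc.IH assms(5) majorized_power[OF r assms(4)]])
       (use s in \<open>simp add: field_simps\<close>)
qed (auto intro: majorized_const)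

lemma majorized_mon_diff:
  assumes r: "r > 0" and s: "s > 0"
    and "\<And>i. i < m \<Longrightarrow> majorized k r s (\<lambda>x. \<tau> x i)" "\<And>i. i < m \<Longrightarrow> majorized k r s (\<lambda>x. \<tau>' x i)"
    and "\<And>i. i < m \<Longrightarrow> majorized k r d (\<lambda>x. \<tau> x i - \<tau>' x i)"
  shows "majorized k r (d / s * deg m \<alpha> * s ^ deg m \<alpha>) (\<lambda>x. mon m \<alpha> (\<tau> x) - mon m \<alpha> (\<tau>' x))"
  using assms(3-)
proof (induction m)
  case (Suc m)
  show ?case unfolding mon_Suc
    by (rule majorized_mult_diff[OF r majorized_prod_power[OF r] majorized_power_diff[OF r s] Suc.IH
          majorized_power[OF r, of k s]])
       (use s Suc.prems in \<open>auto simp: field_simps deg_Suc power_add\<close>)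
qed (auto intro: majorized_const)

text \<open>The Lipschitz constant is proportional to \<open>s\<close>, hence arbitrarily small near
  the origin. In degree n >= 2 the factor n is at most 2^n, which \<open>2 * s \<le> R\<close>
  absorbs: n s^n <= 4 s^2 (2 s)^(n-2) <= 4 s^2 R^(n-2). The quotient \<open>d / s\<close> then
  cancels one power of \<open>s\<close>.\<close>

lemma majorized_quadratic_lipschitz:
  assumes r: "r > 0" and s: "s > 0" "2 * s \<le> R" and d: "d \<ge> 0"
    and q: "series_bound m R M a q" and a: "\<And>\<alpha>. deg m \<alpha> \<le> 1 \<Longrightarrow> a \<alpha> = 0"
    and \<tau>: "\<And>i. i < m \<Longrightarrow> majorized k r s (\<lambda>x. \<tau> x i)" "\<And>i. i < m \<Longrightarrow> majorized k r s (\<lambda>x. \<tau>' x i)"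
    and diff: "\<And>i. i < m \<Longrightarrow> majorized k r d (\<lambda>x. \<tau> x i - \<tau>' x i)"
  shows "majorized k r (4 * s * M / R\<^sup>2 * d) (\<lambda>x. q (\<tau> x) - q (\<tau>' x))"
proof -
  have R: "R > 0" using s by simp
  let ?c = "4 * s * d / R\<^sup>2"
  show ?thesis
  proof (rule majorized_infsum[where I="multi_indices m"
        and h="\<lambda>\<alpha> x. a \<alpha> * (mon m \<alpha> (\<tau> x) - mon m \<alpha> (\<tau>' x))"
        and N="\<lambda>\<alpha>. ?c * (norm (a \<alpha>) * R ^ deg m \<alpha>)"])
    fix \<alpha>
    have "norm (a \<alpha>) * (d / s * deg m \<alpha> * s ^ deg m \<alpha>) \<le> ?c * (norm (a \<alpha>) * R ^ deg m \<alpha>)"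
    proof (cases "deg m \<alpha> \<le> 1")
      case False
      hence n: "deg m \<alpha> = (deg m \<alpha> - 2) + 2" by simp
      define n where "n = deg m \<alpha> - 2"
      note n = n[folded n_def]
      have "real (deg m \<alpha>) * s ^ deg m \<alpha> \<le> 2 ^ deg m \<alpha> * s ^ deg m \<alpha>"
        using s by (intro mult_right_mono) (auto simp: less_imp_le of_nat_less_two_power)
      also have "\<dots> = 4 * s\<^sup>2 * (2 * s) ^ n" by (simp add: n power_mult_distrib power_add power2_eq_square)
      also have "\<dots> \<le> 4 * s\<^sup>2 * R ^ n" using s by (intro mult_left_mono power_mono) auto
      also have "\<dots> = 4 * s\<^sup>2 / R\<^sup>2 * R ^ deg m \<alpha>" using R by (simp add: n power_add power2_eq_square)
      finally have "norm (a \<alpha>) * (d / s) * (real (deg m \<alpha>) * s ^ deg m \<alpha>)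
            \<le> norm (a \<alpha>) * (d / s) * (4 * s\<^sup>2 / R\<^sup>2 * R ^ deg m \<alpha>)"
        using s d by (intro mult_left_mono) auto
      also have "\<dots> = ?c * (norm (a \<alpha>) * R ^ deg m \<alpha>)"
        using s by (simp add: power2_eq_square)
      finally show ?thesis by (simp add: mult_ac)
    qed (use a in simp)
    from majorized_mono[OF majorized_cmult[OF r majorized_mon_diff[OF r s(1) \<tau> diff]] this]
    show "majorized k r (?c * (norm (a \<alpha>) * R ^ deg m \<alpha>)) (\<lambda>x. a \<alpha> * (mon m \<alpha> (\<tau> x) - mon m \<alpha> (\<tau>' x)))" .
  next
    show "(\<lambda>\<alpha>. ?c * (norm (a \<alpha>) * R ^ deg m \<alpha>)) summable_on multi_indices m"
      using q by (intro summable_on_cmult_right) (simp add: series_bound_def)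
    have "(\<Sum>\<^sub>\<infinity>\<alpha>\<in>multi_indices m. ?c * (norm (a \<alpha>) * R ^ deg m \<alpha>)) \<le> ?c * M"
      unfolding infsum_cmult_right' using q s d by (intro mult_left_mono) (auto simp: series_bound_def)
    thus "(\<Sum>\<^sub>\<infinity>\<alpha>\<in>multi_indices m. ?c * (norm (a \<alpha>) * R ^ deg m \<alpha>)) \<le> 4 * s * M / R\<^sup>2 * d"
      by (simp add: mult_ac)
  next
    fix x assume x: "polydisc k r x"
    have *: "((\<lambda>\<alpha>. a \<alpha> * mon m \<alpha> (\<tau>'' x)) has_sum q (\<tau>'' x)) (multi_indices m)"
      if "\<And>i. i < m \<Longrightarrow> majorized k r s (\<lambda>x. \<tau>'' x i)" for \<tau>''
    proof -
      have "norm (\<tau>'' x i) \<le> R" if "i < m" for i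
        using majorized_norm_le[OF \<open>\<And>i. i < m \<Longrightarrow> majorized k r s (\<lambda>x. \<tau>'' x i)\<close>[OF that] x] s by linarith
      thus ?thesis using q by (simp add: series_bound_def)
    qed
    show "((\<lambda>\<alpha>. a \<alpha> * (mon m \<alpha> (\<tau> x) - mon m \<alpha> (\<tau>' x))) has_sum q (\<tau> x) - q (\<tau>' x)) (multi_indices m)"
      using has_sum_diff[OF *[of \<tau>] *[of \<tau>']] \<tau> by (simp add: right_diff_distrib)
  qed (rule r)
qed

text \<open>Compared along majorized germs (rather than points), so that it serves both the fixed
  point iteration in the space of germs and pointwise estimates.\<close>

definition lipschitz_germ :: "nat \<Rightarrow> real \<Rightarrow> real \<Rightarrow> ((nat \<Rightarrow> complex) \<Rightarrow> complex) \<Rightarrow> bool" where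
  "lipschitz_germ m s \<eta> q \<longleftrightarrow> (\<forall>k r d \<tau> \<tau>'. r > 0 \<longrightarrow> d \<ge> 0 \<longrightarrow>
     (\<forall>i<m. majorized k r s (\<lambda>x. \<tau> x i) \<and> majorized k r s (\<lambda>x. \<tau>' x i) \<and>
            majorized k r d (\<lambda>x. \<tau> x i - \<tau>' x i)) \<longrightarrow>
     majorized k r (\<eta> * d) (\<lambda>x. q (\<tau> x) - q (\<tau>' x)))"

text \<open>Stands for "no terms of degree below two, up to a constant", but records only what the
  contraction and the limit arguments use, without reference to coefficients.\<close>

definition superlinear :: "nat \<Rightarrow> ((nat \<Rightarrow> complex) \<Rightarrow> complex) \<Rightarrow> bool" where
  "superlinear m q \<longleftrightarrow> (\<forall>\<eta>>0. \<exists>s>0. lipschitz_germ m s \<eta> q)"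

lemma lipschitz_germD:
  assumes "lipschitz_germ m s \<eta> q" "r > 0" "d \<ge> 0"
    and "\<And>i. i < m \<Longrightarrow> majorized k r s (\<lambda>x. \<tau> x i)" "\<And>i. i < m \<Longrightarrow> majorized k r s (\<lambda>x. \<tau>' x i)"
    and "\<And>i. i < m \<Longrightarrow> majorized k r d (\<lambda>x. \<tau> x i - \<tau>' x i)"
  shows "majorized k r (\<eta> * d) (\<lambda>x. q (\<tau> x) - q (\<tau>' x))"
  using assms(1)[unfolded lipschitz_germ_def, rule_format, of r d k \<tau> \<tau>'] assms(2-) by blast

text \<open>A point is a tuple of germs in zero variables, whose norms are absolute values; the
  estimate along germs therefore contains the pointwise one.\<close>

lemma lipschitz_germ_pointwise:
  assumes "lipschitz_germ m s \<eta> q" "polydisc m s x" "polydisc m s y" "d \<ge> 0"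
    and "\<And>i. i < m \<Longrightarrow> norm (x i - y i) \<le> d"
  shows "norm (q x - q y) \<le> \<eta> * d"
proof -
  have "majorized 0 1 (\<eta> * d) (\<lambda>_. q x - q y)"
    by (rule lipschitz_germD[OF assms(1)]) (use assms in \<open>auto intro!: majorized_const\<close>)
  from majorized_norm_le[OF this] show ?thesis by auto
qed

lemma deg_le_1_cases:
  assumes "\<alpha> \<in> multi_indices m" "deg m \<alpha> \<le> 1"
  shows "\<alpha> = (\<lambda>_. 0) \<or> (\<exists>j<m. \<alpha> = (\<lambda>_. 0)(j := 1))"
proof (cases "deg m \<alpha> = 0")
  case True
  hence "\<forall>i<m. \<alpha> i = 0" by (simp add: deg_def)
  with assms(1) have "\<alpha> i = 0" for i by (cases "i < m") (auto simp: multi_indices_def)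
  thus ?thesis by auto
next
  case False
  hence "(\<Sum>i<m. \<alpha> i) = 1" using assms(2) unfolding deg_def by linarith
  then obtain j where j: "j < m" "\<alpha> j = 1" "\<forall>i<m. i \<noteq> j \<longrightarrow> \<alpha> i = 0"
    by (subst (asm) sum_eq_1_iff) auto
  have "\<alpha> i = ((\<lambda>_. 0)(j := 1)) i" for i
    using j assms(1) by (cases "i < m") (auto simp: multi_indices_def)
  thus ?thesis using j by blast
qed

lemma mon_unit: "j < m \<Longrightarrow> mon m ((\<lambda>_. 0)(j := 1)) x = x j"
  using mon_upd[of j m "\<lambda>_. 0" x] by simp

lemma deg_unit: "j < m \<Longrightarrow> deg m ((\<lambda>_. 0)(j := 1)) = 1"
  using deg_upd[of j m "\<lambda>_. 0"] by simp

lemma series_bound_at_0: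
  assumes "r > 0" "series_bound m r M a g"
  shows "g (\<lambda>_. 0) = a (\<lambda>_. 0)"
proof -
  have "((\<lambda>\<alpha>. a \<alpha> * mon m \<alpha> (\<lambda>_. 0)) has_sum g (\<lambda>_. 0)) (multi_indices m)"
    using assms by (auto simp: series_bound_def)
  moreover have "((\<lambda>\<alpha>. a \<alpha> * mon m \<alpha> (\<lambda>_. 0)) has_sum a (\<lambda>_. 0)) (multi_indices m)"
  proof (rule has_sum_finite_neutralI[where B="{\<lambda>_. 0}"])
    fix \<alpha> assume "\<alpha> \<in> multi_indices m - {\<lambda>_. 0}"
    then obtain i where "\<alpha> i \<noteq> 0" "\<forall>i\<ge>m. \<alpha> i = 0"
      unfolding multi_indices_def fun_eq_iff by blast
    moreover from this have "i < m" by (meson not_less)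
    ultimately
    show "a \<alpha> * mon m \<alpha> (\<lambda>_. 0) = 0" by (auto simp: mon_def intro!: bexI[of _ i])
  qed auto
  ultimately show ?thesis using has_sum_unique by blast
qed

lemma convergent_series_linear_part:
  assumes "g \<in> convergent_series m"
  obtains l where "superlinear m (\<lambda>x. g x - g (\<lambda>_. 0) - (\<Sum>j<m. l j * x j))"
proof -
  obtain R M a where R: "R > 0" and a: "series_bound m R M a g"
    using assms by (auto simp: convergent_series_iff_majorized majorized_def)
  define e :: "nat \<Rightarrow> nat \<Rightarrow> nat" where "e j = (\<lambda>_. 0)(j := 1)" for j
  define b where "b \<alpha> = (if deg m \<alpha> \<le> 1 then 0 else a \<alpha>)" for \<alpha>
  define q where "q x = g x - g (\<lambda>_. 0) - (\<Sum>j<m. a (e j) * x j)" for x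
  have e_eval: "e j i = (if i = j then 1 else 0)" for i j by (simp add: e_def)
  have e_inj: "inj_on e {..<m}"
    by (rule inj_onI) (metis e_eval zero_neq_one)
  have e_ne: "(\<lambda>_. 0) \<notin> e ` {..<m}"
    by (metis e_eval imageE zero_neq_one)
  have D: "insert (\<lambda>_. 0) (e ` {..<m}) \<subseteq> multi_indices m"
    by (auto simp: e_def multi_indices_def)
  have q: "series_bound m R M b q"
  proof (rule series_boundI)
    have s: "(\<lambda>\<alpha>. norm (a \<alpha>) * R ^ deg m \<alpha>) summable_on multi_indices m" 
      using a by (simp add: series_bound_def)
    show s': "(\<lambda>\<alpha>. norm (b \<alpha>) * R ^ deg m \<alpha>) summable_on multi_indices m"
      by (rule summable_on_comparison_test[OF s]) (use R in \<open>auto simp: b_def\<close>)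
    have "(\<Sum>\<^sub>\<infinity>\<alpha>\<in>multi_indices m. norm (b \<alpha>) * R ^ deg m \<alpha>) \<le> (\<Sum>\<^sub>\<infinity>\<alpha>\<in>multi_indices m. norm (a \<alpha>) * R ^ deg m \<alpha>)"
      by (rule infsum_mono[OF s' s]) (use R in \<open>auto simp: b_def\<close>)
    thus "(\<Sum>\<^sub>\<infinity>\<alpha>\<in>multi_indices m. norm (b \<alpha>) * R ^ deg m \<alpha>) \<le> M"
      using a by (simp add: series_bound_def)
    fix x assume x: "polydisc m R x"
    have 1: "((\<lambda>\<alpha>. a \<alpha> * mon m \<alpha> x) has_sum g x) (multi_indices m)"
      using a x by (simp add: series_bound_def)
    have 2: "((\<lambda>\<alpha>. (a \<alpha> - b \<alpha>) * mon m \<alpha> x) has_sum g (\<lambda>_. 0) + (\<Sum>j<m. a (e j) * x j)) (multi_indices m)"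
    proof (rule has_sum_finite_neutralI[where B="insert (\<lambda>_. 0) (e ` {..<m})"])
      show "(a \<alpha> - b \<alpha>) * mon m \<alpha> x = 0" if "\<alpha> \<in> multi_indices m - insert (\<lambda>_. 0) (e ` {..<m})" for \<alpha>
        using deg_le_1_cases[of \<alpha> m] that by (auto simp: b_def e_def)
      show "g (\<lambda>_. 0) + (\<Sum>j<m. a (e j) * x j) = (\<Sum>\<alpha>\<in>insert (\<lambda>_. 0) (e ` {..<m}). (a \<alpha> - b \<alpha>) * mon m \<alpha> x)"
      proof -
        have "(a (e j) - b (e j)) * mon m (e j) x = a (e j) * x j" if "j < m" for j
          using that by (simp add: b_def e_def deg_unit[simplified] mon_unit[simplified] del: fun_upd_apply)
        thus ?thesis
          using e_ne by (simp add: sum.reindex[OF e_inj] series_bound_at_0[OF R a] b_def[of "\<lambda>_. 0"])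
      qed
    qed (use D in auto)
    show "((\<lambda>\<alpha>. b \<alpha> * mon m \<alpha> x) has_sum q x) (multi_indices m)"
      using has_sum_diff[OF 1 2] by (simp add: q_def algebra_simps)
  qed
  have "superlinear m q"
    unfolding superlinear_def
  proof (intro allI impI)
    fix \<eta> :: real assume \<eta>: "\<eta> > 0"
    have M: "M \<ge> 0" using majorized_nonneg[OF R, of m M g] a by (auto simp: majorized_def)
    \<comment> \<open>The first entry is what the quadratic estimate requires; the second makes its
      constant at most \<open>\<eta>\<close>. The denominator uses \<open>M + 1\<close> because
      \<open>M\<close> may be zero.\<close>
    define s where "s = min (R / 2) (\<eta> * R\<^sup>2 / (4 * (M + 1)))"
    have s: "s > 0" "2 * s \<le> R" using R \<eta> M by (auto simp: s_def)
    have "s \<le> \<eta> * R\<^sup>2 / (4 * (M + 1))" by (simp add: s_def)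
    hence "s * (4 * (M + 1)) \<le> \<eta> * R\<^sup>2"
      using M by (subst (asm) pos_le_divide_eq) auto
    hence "4 * s * M \<le> \<eta> * R\<^sup>2" using s by (simp add: algebra_simps)
    hence le: "4 * s * M / R\<^sup>2 \<le> \<eta>" using R by (subst pos_divide_le_eq) auto
    have "lipschitz_germ m s \<eta> q"
      unfolding lipschitz_germ_def
    proof (intro allI impI)
      fix k r d \<tau> \<tau>' assume r: "0 < (r::real)" "0 \<le> (d::real)"
        and \<tau>: "\<forall>i<m. majorized k r s (\<lambda>x. \<tau> x i) \<and> majorized k r s (\<lambda>x. \<tau>' x i) \<and>
              majorized k r d (\<lambda>x. \<tau> x i - \<tau>' x i)"
      have "majorized k r (4 * s * M / R\<^sup>2 * d) (\<lambda>x. q (\<tau> x) - q (\<tau>' x))"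
        by (rule majorized_quadratic_lipschitz[OF r(1) s r(2) q]) (use \<tau> in \<open>auto simp: b_def\<close>)
      thus "majorized k r (\<eta> * d) (\<lambda>x. q (\<tau> x) - q (\<tau>' x))"
        by (rule majorized_mono) (rule mult_right_mono[OF le r(2)])
    qed
    thus "\<exists>s>0. lipschitz_germ m s \<eta> q" using s(1) by blast
  qed
  thus ?thesis by (intro that[of "\<lambda>j. a (e j)"]) (simp only: q_def[abs_def])
qed

section \<open>Closure properties of convergent series\<close>

lemma convergent_series_common_radius:
  assumes "finite I" "\<And>i. i \<in> I \<Longrightarrow> g i \<in> convergent_series m"
  obtains r M where "r > 0" "\<And>i. i \<in> I \<Longrightarrow> majorized m r M (g i)"
proof -
  have "\<exists>r>0. \<exists>M. \<forall>i\<in>I. majorized m r M (g i)"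
    using assms
  proof (induction I)
    case (insert j I)
    then obtain r M r' M' where *: "r > 0" "\<forall>i\<in>I. majorized m r M (g i)" "r' > 0" "majorized m r' M' (g j)"
      by (auto simp: convergent_series_iff_majorized) metis
    hence "majorized m (min r r') (max M M') (g i)" if "i \<in> insert j I" for i
      using that by (auto intro: majorized_mono[OF majorized_shrink[of "min r r'" r]]
          majorized_mono[OF majorized_shrink[of "min r r'" r']])
    thus ?case using * by (intro exI[of _ "min r r'"]) auto
  qed (auto intro: exI[of _ 1])
  thus ?thesis using that by blast
qed

lemma convergent_series_coord: "i < m \<Longrightarrow> (\<lambda>x. x i) \<in> convergent_series m"
  using majorized_coord[of 1 i m] by (auto simp: convergent_series_iff_majorized intro: exI[of _ 1])

lemma
  assumes "f \<in> convergent_series m" "g \<in> convergent_series m"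
  shows convergent_series_diff: "(\<lambda>x. f x - g x) \<in> convergent_series m"
    and convergent_series_mult: "(\<lambda>x. f x * g x) \<in> convergent_series m"
proof -
  obtain r M where r: "r > 0" and M: "\<And>b. b \<in> UNIV \<Longrightarrow> majorized m r M (if b then f else g)"
    by (rule convergent_series_common_radius[of UNIV "\<lambda>b. if b then f else g" m]) (use assms in auto)
  from M[of True] M[of False] have "majorized m r M f" "majorized m r M g" by simp_all
  thus "(\<lambda>x. f x - g x) \<in> convergent_series m" "(\<lambda>x. f x * g x) \<in> convergent_series m"
    using majorized_diff[of r m M f M g] majorized_mult[of r m M f M g] r
    by (auto simp: convergent_series_iff_majorized)
qed

lemma convergent_series_sum:
  assumes "finite I" "\<And>i. i \<in> I \<Longrightarrow> g i \<in> convergent_series m"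
  shows "(\<lambda>x. \<Sum>i\<in>I. g i x) \<in> convergent_series m"
proof -
  obtain r M where r: "r > 0" "\<And>i. i \<in> I \<Longrightarrow> majorized m r M (g i)"
    using convergent_series_common_radius[of I g m, OF assms] by blast
  have "majorized m r (\<Sum>i\<in>I. M) (\<lambda>x. \<Sum>i\<in>I. g i x)"
    by (rule majorized_sum) (use r assms in auto)
  thus ?thesis using r by (auto simp: convergent_series_iff_majorized)
qed

text \<open>The weights \<open>\<omega> i = \<epsilon>\<^sup>i\<close> make the strictly upper triangular linear part a contraction.\<close>

lemma triangular_contraction:
  assumes q: "\<And>i. i < m \<Longrightarrow> superlinear m (\<lambda>x. g i x - (\<Sum>j<m. l i j * x j))"
    and l: "\<And>i j. i < m \<Longrightarrow> j \<le> i \<Longrightarrow> l i j = 0"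
  obtains \<omega> :: "nat \<Rightarrow> real" and s :: real
  where "\<And>i. 0 < \<omega> i" "\<And>i. \<omega> i \<le> 1" "s > 0"
    "\<And>i k r \<delta> \<tau> \<tau>'. i < m \<Longrightarrow> r > 0 \<Longrightarrow> \<delta> \<ge> 0 \<Longrightarrow>
       (\<And>j. j < m \<Longrightarrow> majorized k r s (\<lambda>x. \<tau> x j)) \<Longrightarrow>
       (\<And>j. j < m \<Longrightarrow> majorized k r s (\<lambda>x. \<tau>' x j)) \<Longrightarrow>
       (\<And>j. j < m \<Longrightarrow> majorized k r (\<delta> * \<omega> j) (\<lambda>x. \<tau> x j - \<tau>' x j)) \<Longrightarrow>
       majorized k r (\<delta> * \<omega> i / 2) (\<lambda>x. g i (\<tau> x) - g i (\<tau>' x))"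
proof -
  \<comment> \<open>\<open>K\<close> dominates every row sum of the matrix \<open>l\<close>. As only
    entries with j > i survive and there \<open>\<omega> j \<le> \<epsilon> * \<omega> i\<close>,
    the choice \<open>K * \<epsilon> = 1 / 4\<close> lets the linear part use one quarter of
    \<open>\<delta> * \<omega> i\<close>. The superlinear part gets another quarter, because
    \<open>\<eta>\<close> is a quarter of a number below every weight.\<close>
  define K where "K = 1 + (\<Sum>i<m. \<Sum>j<m. norm (l i j))"
  have K: "K \<ge> 1" by (auto simp: K_def intro!: sum_nonneg)
  define \<epsilon> where "\<epsilon> = 1 / (4 * K)"
  have \<epsilon>: "0 < \<epsilon>" "\<epsilon> \<le> 1" "K * \<epsilon> = 1 / 4" using K by (auto simp: \<epsilon>_def)
  define \<omega> where "\<omega> i = \<epsilon> ^ i" for i :: nat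
  define \<eta> where "\<eta> = \<epsilon> ^ m / 4"
  have \<eta>: "\<eta> > 0" using \<epsilon> by (simp add: \<eta>_def)
  have \<omega>: "0 < \<omega> i" "\<omega> i \<le> 1" for i using \<epsilon> by (auto simp: \<omega>_def power_le_one)
  have \<omega>\<eta>: "\<eta> \<le> \<omega> i / 4" if "i < m" for i
    using \<epsilon> that by (auto simp: \<eta>_def \<omega>_def intro!: power_decreasing)
  have "\<forall>i\<in>{..<m}. \<exists>s>0. lipschitz_germ m s \<eta> (\<lambda>x. g i x - (\<Sum>j<m. l i j * x j))"
    using q \<eta> unfolding superlinear_def by blast
  then obtain S where S: "\<And>i. i < m \<Longrightarrow> S i > 0"
    "\<And>i. i < m \<Longrightarrow> lipschitz_germ m (S i) \<eta> (\<lambda>x. g i x - (\<Sum>j<m. l i j * x j))"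
    unfolding bchoice_iff by blast
  define s where "s = Min (insert 1 (S ` {..<m}))"
  have s: "s > 0" "\<And>i. i < m \<Longrightarrow> s \<le> S i" using S by (auto simp: s_def)
  show ?thesis
  proof (rule that[OF \<omega> s(1)])
    fix i k :: nat and r \<delta> :: real and \<tau> \<tau>' :: "(nat \<Rightarrow> complex) \<Rightarrow> nat \<Rightarrow> complex"
    assume i: "i < m" and r: "r > 0" and \<delta>: "\<delta> \<ge> 0" 
      and \<tau>: "\<And>j. j < m \<Longrightarrow> majorized k r s (\<lambda>x. \<tau> x j)" "\<And>j. j < m \<Longrightarrow> majorized k r s (\<lambda>x. \<tau>' x j)"
      and diff: "\<And>j. j < m \<Longrightarrow> majorized k r (\<delta> * \<omega> j) (\<lambda>x. \<tau> x j - \<tau>' x j)"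
    have 1: "majorized k r (\<eta> * \<delta>) (\<lambda>x. (g i (\<tau> x) - (\<Sum>j<m. l i j * \<tau> x j)) - (g i (\<tau>' x) - (\<Sum>j<m. l i j * \<tau>' x j)))"
    proof (rule lipschitz_germD[OF S(2)[OF i] r \<delta>])
      fix j assume j: "j < m"
      show "majorized k r (S i) (\<lambda>x. \<tau> x j)" "majorized k r (S i) (\<lambda>x. \<tau>' x j)"
        using majorized_mono[OF \<tau>(1)[OF j] s(2)[OF i]] majorized_mono[OF \<tau>(2)[OF j] s(2)[OF i]] .
      show "majorized k r \<delta> (\<lambda>x. \<tau> x j - \<tau>' x j)"
        by (rule majorized_mono[OF diff[OF j]]) (use \<delta> \<omega> mult_left_mono[of "\<omega> j" 1 \<delta>] in auto)
    qed
    have 2: "majorized k r (\<Sum>j<m. norm (l i j) * (\<delta> * \<omega> j)) (\<lambda>x. \<Sum>j<m. l i j * (\<tau> x j - \<tau>' x j))"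
      by (rule majorized_sum[OF r]) (auto intro!: majorized_cmult r diff)
    have "(\<Sum>j<m. norm (l i j) * (\<delta> * \<omega> j)) \<le> (\<Sum>j<m. norm (l i j) * (\<delta> * (\<epsilon> * \<omega> i)))"
    proof (rule sum_mono)
      fix j
      have "\<omega> j \<le> \<epsilon> * \<omega> i" if "j > i"
        using power_decreasing[of "Suc i" j \<epsilon>] that \<epsilon> by (auto simp: \<omega>_def)
      thus "norm (l i j) * (\<delta> * \<omega> j) \<le> norm (l i j) * (\<delta> * (\<epsilon> * \<omega> i))"
        using l[OF i, of j] \<delta> by (cases "j \<le> i") (auto intro!: mult_left_mono)
    qed
    also have "\<dots> = (\<Sum>j<m. norm (l i j)) * (\<delta> * (\<epsilon> * \<omega> i))"
      by (rule sum_distrib_right[symmetric])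
    also have "\<dots> \<le> K * (\<delta> * (\<epsilon> * \<omega> i))"
    proof (rule mult_right_mono)
      have "(\<Sum>j<m. norm (l i j)) \<le> (\<Sum>i<m. \<Sum>j<m. norm (l i j))"
        by (rule member_le_sum[of i]) (use i in \<open>auto intro: sum_nonneg\<close>)
      thus "(\<Sum>j<m. norm (l i j)) \<le> K" by (simp add: K_def)
    qed (use \<delta> \<epsilon> \<omega>[of i] in auto)
    also have "\<dots> = (K * \<epsilon>) * (\<delta> * \<omega> i)" by (simp add: mult_ac)
    finally have 3: "(\<Sum>j<m. norm (l i j) * (\<delta> * \<omega> j)) \<le> \<delta> * \<omega> i / 4" using \<epsilon>(3) by simp
    have "\<eta> * \<delta> \<le> \<delta> * \<omega> i / 4" using mult_left_mono[OF \<omega>\<eta>[OF i] \<delta>] by (simp add: mult_ac)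
    with 3 have le: "\<eta> * \<delta> + (\<Sum>j<m. norm (l i j) * (\<delta> * \<omega> j)) \<le> \<delta> * \<omega> i / 2" by simp
    have "majorized k r (\<delta> * \<omega> i / 2) (\<lambda>x. ((g i (\<tau> x) - (\<Sum>j<m. l i j * \<tau> x j)) - (g i (\<tau>' x) - (\<Sum>j<m. l i j * \<tau>' x j)))
             + (\<Sum>j<m. l i j * (\<tau> x j - \<tau>' x j)))"
      by (rule majorized_mono[OF majorized_add[OF r 1 2] le])
    thus "majorized k r (\<delta> * \<omega> i / 2) (\<lambda>x. g i (\<tau> x) - g i (\<tau>' x))"
      by (simp add: right_diff_distrib sum_subtractf)
  qed
qed

section \<open>Inversion of perturbations of the identity\<close>

lemma analytic_self_germ_id_minus:
  assumes "\<And>i. i < m \<Longrightarrow> g i \<in> convergent_series m" "\<And>i. i < m \<Longrightarrow> g i (\<lambda>_. 0) = 0"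
  shows "analytic_self_germ m (\<lambda>x i. x i - g i x)"
  using assms by (auto simp: analytic_self_germ_def intro: convergent_series_diff convergent_series_coord)

text \<open>The inverse \<open>\<tau>\<close> is the limit of the Picard iterates of \<open>\<tau> = x + g(\<tau>)\<close>.\<close>

lemma Diff_id_minus:
  assumes g: "\<And>i. i < m \<Longrightarrow> g i \<in> convergent_series m" "\<And>i. i < m \<Longrightarrow> g i (\<lambda>_. 0) = 0"
    and q: "\<And>i. i < m \<Longrightarrow> superlinear m (\<lambda>x. g i x - (\<Sum>j<m. l i j * x j))"
    and l: "\<And>i j. i < m \<Longrightarrow> j \<le> i \<Longrightarrow> l i j = 0"
  shows "(\<lambda>x i. x i - g i x) \<in> Diff m"
proof (rule triangular_contraction[OF q l])
  fix \<omega> :: "nat \<Rightarrow> real" and s :: real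
  assume \<omega>: "\<And>i. 0 < \<omega> i" "\<And>i. \<omega> i \<le> 1" and s: "s > 0"
    and contr: "\<And>i k r \<delta> \<tau> \<tau>'. i < m \<Longrightarrow> r > 0 \<Longrightarrow> \<delta> \<ge> 0 \<Longrightarrow>
       (\<And>j. j < m \<Longrightarrow> majorized k r s (\<lambda>x. \<tau> x j)) \<Longrightarrow>
       (\<And>j. j < m \<Longrightarrow> majorized k r s (\<lambda>x. \<tau>' x j)) \<Longrightarrow>
       (\<And>j. j < m \<Longrightarrow> majorized k r (\<delta> * \<omega> j) (\<lambda>x. \<tau> x j - \<tau>' x j)) \<Longrightarrow>
       majorized k r (\<delta> * \<omega> i / 2) (\<lambda>x. g i (\<tau> x) - g i (\<tau>' x))"
  have pcontr: "norm (g i y - g i z) \<le> \<delta> * \<omega> i / 2"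
    if "i < m" "\<delta> \<ge> 0" "polydisc m s y" "polydisc m s z" "\<And>j. j < m \<Longrightarrow> norm (y j - z j) \<le> \<delta> * \<omega> j"
    for i \<delta> y z
  proof -
    have "majorized 0 1 (\<delta> * \<omega> i / 2) (\<lambda>_. g i y - g i z)"
      by (rule contr) (use that in \<open>auto intro!: majorized_const\<close>)
    from majorized_norm_le[OF this] show ?thesis by simp
  qed
  \<comment> \<open>The iteration only produces a right inverse. Injectivity makes it a left inverse
    too, since the right inverse applied to the image of x has the same image as x. The largest
    weighted difference \<open>\<delta>\<close> of two points with equal image satisfies \<delta>
    \<le> \<delta>/2.\<close>
  have inj: "y i = z i"
    if y: "polydisc m s y" and z: "polydisc m s z" and eq: "\<And>i. i < m \<Longrightarrow> y i - g i y = z i - g i z" 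
      and i: "i < m" for y z i
  proof -
    define \<delta> where "\<delta> = Max ((\<lambda>j. norm (y j - z j) / \<omega> j) ` {..<m})"
    have le: "norm (y j - z j) \<le> \<delta> * \<omega> j" if "j < m" for j
    proof -
      have "norm (y j - z j) / \<omega> j \<le> \<delta>" using that by (auto simp: \<delta>_def)
      thus ?thesis using \<omega>(1)[of j] by (simp add: field_simps)
    qed
    have "\<delta> \<in> (\<lambda>j. norm (y j - z j) / \<omega> j) ` {..<m}"
      unfolding \<delta>_def using i by (intro Max_in) auto
    then obtain j where j: "j < m" "\<delta> = norm (y j - z j) / \<omega> j" by auto
    have \<delta>0: "\<delta> \<ge> 0" using j \<omega>(1)[of j] by simp
    have "y j - z j = g j y - g j z" using eq[OF j(1)] by (simp add: algebra_simps)
    hence "norm (y j - z j) \<le> \<delta> * \<omega> j / 2" using pcontr[OF j(1) \<delta>0 y z le] by simp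
    moreover have "norm (y j - z j) = \<delta> * \<omega> j" using j(2) \<omega>(1)[of j] by simp
    ultimately have "\<delta> * \<omega> j \<le> 0" by simp
    hence "\<delta> = 0" using \<delta>0 \<omega>(1)[of j] by (simp add: mult_le_0_iff)
    thus ?thesis using le[OF i] by simp
  qed
  define \<mu> where "\<mu> = Min (insert 1 (\<omega> ` {..<m}))"
  have \<mu>: "\<mu> > 0" "\<mu> \<le> 1" "\<And>i. i < m \<Longrightarrow> \<mu> \<le> \<omega> i" using \<omega> by (auto simp: \<mu>_def)
  \<comment> \<open>The first Picard increment is x itself, of norm
    \<open>r \<le> \<delta> * \<omega> i\<close>, and each later one is half as large. All iterates
    thus stay below \<open>2 * \<delta> * \<omega> i\<close>, hence below \<open>s\<close>, where
    the contraction estimate applies; \<open>T_bounds\<close> carries the partial sums of this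
    geometric series.\<close>
  define \<delta> where "\<delta> = s / 2"
  define r where "r = \<delta> * \<mu>"
  have \<delta>: "\<delta> > 0" using s by (simp add: \<delta>_def)
  have r: "r > 0" using \<delta> \<mu> by (simp add: r_def)
  have r\<omega>: "r \<le> \<delta> * \<omega> i" if "i < m" for i using \<mu>(3)[OF that] \<delta> by (simp add: r_def)
  define T :: "nat \<Rightarrow> (nat \<Rightarrow> complex) \<Rightarrow> nat \<Rightarrow> complex"
    where "T = rec_nat (\<lambda>_ _. 0) (\<lambda>_ t x i. x i + g i (t x))"
  have T0: "T 0 x i = 0" and TS: "T (Suc k) x i = x i + g i (T k x)" for k x i
    by (simp_all add: T_def)
  have T_bounds: "\<forall>i<m. majorized m r (\<delta> * \<omega> i * (2 - 2 / 2 ^ k)) (\<lambda>x. T k x i)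
      \<and> majorized m r (\<delta> / 2 ^ k * \<omega> i) (\<lambda>x. T (Suc k) x i - T k x i)" for k
  proof (induction k)
    case 0
    have "T 0 = (\<lambda>_ _. 0)" by (simp add: T_def)
    thus ?case using g(2) r\<omega> by (auto simp: TS intro: majorized_const majorized_mono[OF majorized_coord[OF r]])
  next
    case (Suc k)
    have le_s: "\<delta> * \<omega> i * (2 - 2 / 2 ^ n) \<le> s" for i n
    proof -
      have "\<delta> * \<omega> i * (2 - 2 / 2 ^ n) \<le> \<delta> * \<omega> i * 2"
        using \<delta> \<omega>(1)[of i] by (intro mult_left_mono) auto
      also have "\<dots> \<le> \<delta> * 1 * 2" using \<delta> \<omega>(2)[of i] by (intro mult_right_mono mult_left_mono) auto
      finally show ?thesis by (simp add: \<delta>_def)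
    qed
    have b: "majorized m r (\<delta> * \<omega> i * (2 - 2 / 2 ^ Suc k)) (\<lambda>x. T (Suc k) x i)" if "i < m" for i
    proof -
      have eq: "\<delta> * \<omega> i * (2 - 2 / 2 ^ k) + \<delta> / 2 ^ k * \<omega> i = \<delta> * \<omega> i * (2 - 2 / 2 ^ Suc k)"
        by (simp add: field_simps)
      show ?thesis
        using majorized_add[OF r, of m "\<delta> * \<omega> i * (2 - 2 / 2 ^ k)" "\<lambda>x. T k x i" "\<delta> / 2 ^ k * \<omega> i"
            "\<lambda>x. T (Suc k) x i - T k x i"] Suc.IH that unfolding eq by simp
    qed
    have "majorized m r (\<delta> / 2 ^ k * \<omega> i / 2) (\<lambda>x. g i (T (Suc k) x) - g i (T k x))" if "i < m" for i
    proof (rule contr[OF that r])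
      fix j assume j: "j < m"
      show "majorized m r s (\<lambda>x. T (Suc k) x j)" by (rule majorized_mono[OF b[OF j] le_s])
      show "majorized m r s (\<lambda>x. T k x j)" "majorized m r (\<delta> / 2 ^ k * \<omega> j) (\<lambda>x. T (Suc k) x j - T k x j)"
        using Suc.IH j majorized_mono[OF _ le_s] by blast+
    qed (use \<delta> in simp)
    thus ?case using b by (auto simp: TS[of "Suc k"] TS[of k] simp del: power_Suc) (simp add: mult_ac)
  qed
  \<comment> \<open>Written as a sum of increments instead of a limit, so that
    \<open>majorized_infsum\<close> exhibits it as a convergent power series.\<close>
  define \<tau> where "\<tau> x i = (\<Sum>\<^sub>\<infinity>k. T (Suc k) x i - T k x i)" for x i
  have geo: "((\<lambda>k. \<delta> / 2 ^ k * \<omega> i) has_sum 2 * \<delta> * \<omega> i) UNIV" for i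
  proof -
    have "(\<lambda>k. (1/2) ^ k * (\<delta> * \<omega> i)) sums (1 / (1 - 1/2) * (\<delta> * \<omega> i))"
      by (intro sums_mult2 geometric_sums) auto
    hence "(\<lambda>k. \<delta> / 2 ^ k * \<omega> i) sums (2 * \<delta> * \<omega> i)" by (simp add: power_divide mult.assoc)
    thus ?thesis using \<delta> \<omega>(1)[of i] by (intro sums_nonneg_imp_has_sum) auto
  qed
  have \<tau>_sum: "((\<lambda>k. T (Suc k) x i - T k x i) has_sum \<tau> x i) UNIV" if "i < m" "polydisc m r x" for x i
  proof -
    have "(\<lambda>k. norm (T (Suc k) x i - T k x i)) summable_on UNIV"
      by (rule Infinite_Sum.abs_summable_on_comparison_test'[OF has_sum_imp_summable[OF geo]])
         (use T_bounds majorized_norm_le that in blast)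
    from Infinite_Sum.abs_summable_summable[OF this] show ?thesis
      unfolding \<tau>_def by (rule has_sum_infsum)
  qed
  have \<tau>_lim: "(\<lambda>k. T k x i) \<longlonglongrightarrow> \<tau> x i" if "i < m" "polydisc m r x" for x i
  proof -
    have "(\<lambda>n. \<Sum>k<n. T (Suc k) x i - T k x i) \<longlonglongrightarrow> \<tau> x i"
      using has_sum_imp_sums[OF \<tau>_sum[OF that]] by (simp add: sums_def)
    moreover have "(\<Sum>k<n. T (Suc k) x i - T k x i) = T n x i" for n
      by (induction n) (simp_all add: T0)
    ultimately show ?thesis by simp
  qed
  have \<tau>_maj: "majorized m r s (\<lambda>x. \<tau> x i)" if "i < m" for i
  proof (rule majorized_infsum[OF r, where I=UNIV and N="\<lambda>k. \<delta> / 2 ^ k * \<omega> i" and h="\<lambda>k x. T (Suc k) x i - T k x i"])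
    show "(\<Sum>\<^sub>\<infinity>k. \<delta> / 2 ^ k * \<omega> i) \<le> s"
      using infsumI[OF geo[of i]] \<omega>[of i] s by (simp add: \<delta>_def mult_left_le)
  qed (use T_bounds that geo \<tau>_sum in \<open>auto intro: has_sum_imp_summable\<close>)
  have \<tau>_s: "polydisc m s (\<tau> x)" if "polydisc m r x" for x
    using majorized_norm_le[OF \<tau>_maj that] by blast
  have fixpoint: "\<tau> x i - g i (\<tau> x) = x i" if i: "i < m" and x: "polydisc m r x" for x i
  proof -
    have Ts: "polydisc m s (T k x)" for k
    proof (intro allI impI)
      fix j assume "j < m"
      hence "majorized m r (\<delta> * \<omega> j * (2 - 2 / 2 ^ k)) (\<lambda>x. T k x j)" using T_bounds by blast
      hence "norm (T k x j) \<le> \<delta> * \<omega> j * (2 - 2 / 2 ^ k)" using x majorized_norm_le by blast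
      also have "\<dots> \<le> \<delta> * 1 * 2"
        using \<delta> \<omega>[of j] by (intro mult_mono) (auto simp: divide_le_eq)
      finally show "norm (T k x j) \<le> s" by (simp add: \<delta>_def)
    qed
    have "(\<lambda>k. g i (T k x)) \<longlonglongrightarrow> g i (\<tau> x)"
    proof (rule tendstoI)
      fix e :: real assume e: "e > 0"
      have "\<forall>\<^sub>F k in sequentially. \<forall>j\<in>{..<m}. dist (T k x j) (\<tau> x j) < e * \<omega> j"
        by (rule eventually_ball_finite) (use \<tau>_lim[OF _ x] e \<omega>(1) in \<open>auto intro!: tendstoD\<close>)
      thus "\<forall>\<^sub>F k in sequentially. dist (g i (T k x)) (g i (\<tau> x)) < e"
      proof eventually_elim
        case (elim k)
        hence "norm (g i (T k x) - g i (\<tau> x)) \<le> e * \<omega> i / 2"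
          by (intro pcontr[OF i _ Ts \<tau>_s[OF x]]) (use e in \<open>auto simp: dist_norm less_imp_le\<close>)
        also have "e * \<omega> i \<le> e * 1" using \<omega>(2)[of i] e by (intro mult_left_mono) auto
        hence "e * \<omega> i / 2 < e" using e by simp
        finally show ?case by (simp add: dist_norm)
      qed
    qed
    hence "(\<lambda>k. T (Suc k) x i) \<longlonglongrightarrow> x i + g i (\<tau> x)"
      unfolding TS by (intro tendsto_add tendsto_const)
    moreover have "(\<lambda>k. T (Suc k) x i) \<longlonglongrightarrow> \<tau> x i" using \<tau>_lim[OF i x] by (rule LIMSEQ_Suc)
    ultimately have "\<tau> x i = x i + g i (\<tau> x)" using LIMSEQ_unique by blast
    thus ?thesis by simp
  qed
  \<comment> \<open>On this polydisc every coordinate is at most \<open>r / 2 * \<omega> j\<close>,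
    so comparison with the origin gives \<open>g i x\<close> modulus at most \<open>r / 4\<close>.
    Hence x - g(x) stays in the polydisc of radius \<open>r\<close>, where the fixed point equation
    is known.\<close>
  define \<rho> where "\<rho> = r * \<mu> / 2"
  have \<rho>: "\<rho> > 0" "\<rho> \<le> r / 2" "r / 2 \<le> s"
    using r \<mu> \<delta> mult_left_mono[of \<mu> 1 r] mult_left_mono[of \<mu> 1 \<delta>] by (auto simp: \<rho>_def r_def \<delta>_def)
  have \<sigma>_small: "polydisc m r (\<lambda>i. x i - g i x)" if x: "polydisc m \<rho> x" for x
  proof (intro allI impI)
    fix i assume i: "i < m"
    have "norm (g i x - g i (\<lambda>_. 0)) \<le> r / 2 * \<omega> i / 2"
    proof (rule pcontr[OF i])
      fix j assume j: "j < m"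
      have "norm (x j) \<le> \<rho>" using x j by blast
      also have "\<dots> \<le> r / 2 * \<omega> j" using \<mu>(3)[OF j] r by (simp add: \<rho>_def)
      finally show "norm (x j - 0) \<le> r / 2 * \<omega> j" by simp
    next
      show "polydisc m s x" using x \<rho> by (meson order_trans)
    qed (use s r in auto)
    also have "\<dots> \<le> r / 2 * 1 / 2" using \<omega>(2)[of i] r by simp
    finally have "norm (g i x) \<le> r / 4" using g(2)[OF i] by simp
    moreover have "norm (x i) \<le> r / 2" using x i \<rho> by (meson order_trans)
    ultimately show "norm (x i - g i x) \<le> r" using norm_triangle_ineq4[of "x i" "g i x"] r by linarith
  qed
  have \<tau>\<sigma>: "\<tau> (\<lambda>i. x i - g i x) i = x i" if x: "polydisc m \<rho> x" and i: "i < m" for x i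
  proof (rule inj[OF \<tau>_s _ _ i])
    show "polydisc m r (\<lambda>i. x i - g i x)" by (rule \<sigma>_small[OF x])
    show "polydisc m s x" using x \<rho> by (meson order_trans)
    show "\<tau> (\<lambda>i. x i - g i x) j - g j (\<tau> (\<lambda>i. x i - g i x)) = x j - g j x" if "j < m" for j
      using fixpoint[OF that \<sigma>_small[OF x]] .
  qed
  have "\<tau> (\<lambda>_. 0) i = 0" if "i < m" for i
  proof -
    have 0: "polydisc m r (\<lambda>_. 0 :: complex)" using r by simp
    show ?thesis
      using inj[OF \<tau>_s[OF 0], of "\<lambda>_. 0" i] fixpoint[OF _ 0] g(2) s that by simp
  qed
  hence "analytic_self_germ m \<tau>"
    unfolding analytic_self_germ_def convergent_series_iff_majorized using \<tau>_maj r by blast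
  moreover have "near_origin m (\<lambda>x. \<forall>i<m. \<tau> (\<lambda>i. x i - g i x) i = x i \<and> \<tau> x i - g i (\<tau> x) = x i)"
    unfolding near_origin_def
  proof (intro exI[of _ \<rho>] conjI allI impI \<rho>(1))
    fix x :: "nat \<Rightarrow> complex" and i assume x: "\<forall>i<m. norm (x i) < \<rho>" and i: "i < m"
    have "polydisc m \<rho> x" using x by (simp add: less_imp_le)
    thus "\<tau> (\<lambda>i. x i - g i x) i = x i" using i by (rule \<tau>\<sigma>)
    have "norm (x j) \<le> r" if "j < m" for j
      using x[rule_format, OF that] \<rho>(2) r by linarith
    thus "\<tau> x i - g i (\<tau> x) = x i" using fixpoint[OF i] by blast
  qed
  ultimately show ?thesis
    unfolding Diff_def using analytic_self_germ_id_minus[of m g] g by blast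
qed

section \<open>Germs of high order are pulled back from the ambient space\<close>

definition lin_span :: "'a::comm_ring_1 set \<Rightarrow> (nat \<Rightarrow> 'a) \<Rightarrow> nat \<Rightarrow> 'a set" where
  "lin_span R g n = {f. \<exists>r. (\<forall>i<n. r i \<in> R) \<and> f = (\<Sum>i<n. r i * g i)}"

locale subsemiring =
  fixes R :: "'a::comm_ring_1 set"
  assumes zero: "0 \<in> R" and add: "a \<in> R \<Longrightarrow> b \<in> R \<Longrightarrow> a + b \<in> R"
    and mult: "a \<in> R \<Longrightarrow> b \<in> R \<Longrightarrow> a * b \<in> R"
begin

lemma lin_span_add: "f \<in> lin_span R g n \<Longrightarrow> h \<in> lin_span R g n \<Longrightarrow> f + h \<in> lin_span R g n"
  unfolding lin_span_def
  by clarify (rule_tac x="\<lambda>i. r i + ra i" in exI, simp add: add sum.distrib distrib_right)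

lemma lin_span_scale: "c \<in> R \<Longrightarrow> f \<in> lin_span R g n \<Longrightarrow> c * f \<in> lin_span R g n"
  unfolding lin_span_def
  by clarify (rule_tac x="\<lambda>i. c * r i" in exI, simp add: mult sum_distrib_left mult.assoc)

lemma lin_span_Suc:
  assumes "f \<in> lin_span R g (Suc n)"
  obtains b r where "b \<in> lin_span R g n" "r \<in> R" "f = b + r * g n"
proof -
  obtain r where r: "\<forall>i<Suc n. r i \<in> R" "f = (\<Sum>i<Suc n. r i * g i)"
    using assms by (auto simp: lin_span_def)
  show ?thesis
    by (rule that[of "\<Sum>i<n. r i * g i" "r n"]) (use r in \<open>auto simp: lin_span_def intro!: exI[of _ r]\<close>)
qed

lemma lin_span_mono:
  assumes "n \<le> n'"
  shows "lin_span R g n \<subseteq> lin_span R g n'"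
  using assms
proof (induction rule: dec_induct)
  case (step k)
  have "lin_span R g k \<subseteq> lin_span R g (Suc k)"
    unfolding lin_span_def
  proof clarify
    fix r assume "\<forall>i<k. r i \<in> R"
    thus "\<exists>r'. (\<forall>i<Suc k. r' i \<in> R) \<and> (\<Sum>i<k. r i * g i) = (\<Sum>i<Suc k. r' i * g i)"
      by (intro exI[of _ "r(k := 0)"]) (auto simp: less_Suc_eq zero)
  qed
  with step show ?case by blast
qed simp

text \<open>The hypothesis \<open>unit\<close> says that \<open>x\<close> lies in the Jacobson
  radical. Generators are eliminated one at a time from the last: writing
  \<open>g n = a + x * f'\<close> and expanding \<open>f'\<close> in the first n + 1 generators
  gives \<open>(1 - x * r) * g n = a + x * b\<close> with right side in the span of the first n, and
  the factor is invertible. This replaces the usual determinant.\<close>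

lemma nakayama:
  assumes unit: "\<And>r. r \<in> R \<Longrightarrow> \<exists>r'\<in>R. r' * (1 - x * r) = 1" and x: "x \<in> R"
    and gM: "\<And>i. i < N \<Longrightarrow> g i \<in> M" and M: "M \<subseteq> lin_span R g N" and v: "v \<le> N"
    and step: "\<And>f. f \<in> M \<Longrightarrow> \<exists>a\<in>lin_span R g v. \<exists>f'\<in>M. f = a + x * f'"
  shows "M \<subseteq> lin_span R g v"
  using v
proof (induction rule: inc_induct)
  case base
  show ?case by (rule M)
next
  case (step n)
  from assms(6)[OF gM[OF step(2)]] obtain a f' where a: "a \<in> lin_span R g v" "f' \<in> M" "g n = a + x * f'"
    by blast
  obtain b r where b: "b \<in> lin_span R g n" "r \<in> R" "f' = b + r * g n"
    using lin_span_Suc[of f' g n] step.IH a(2) by blast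
  obtain r' where r': "r' \<in> R" "r' * (1 - x * r) = 1" using unit[OF b(2)] by blast
  have "a \<in> lin_span R g n" using a(1) lin_span_mono[OF step(1)] by blast
  hence s: "r' * (a + x * b) \<in> lin_span R g n"
    by (intro lin_span_scale lin_span_add r' x b)
  have "(1 - x * r) * g n = a + x * b"
    using a(3) by (simp only: b(3)) (simp add: algebra_simps)
  hence "r' * (a + x * b) = (r' * (1 - x * r)) * g n" by (simp only: mult.assoc)
  hence gn: "g n \<in> lin_span R g n" using s r'(2) by simp
  show ?case
  proof
    fix f assume "f \<in> M"
    then obtain b r where "b \<in> lin_span R g n" "r \<in> R" "f = b + r * g n"
      using lin_span_Suc[of f g n] step.IH by blast
    thus "f \<in> lin_span R g n" using gn lin_span_add lin_span_scale by blast
  qed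
qed

end

section \<open>Convergent series in t as a module over those in t^v\<close>

abbreviation convergent_fps :: "complex fps set" where
  "convergent_fps \<equiv> {F. fps_conv_radius F > 0}"

lemma convergent_fps_add: "F \<in> convergent_fps \<Longrightarrow> G \<in> convergent_fps \<Longrightarrow> F + G \<in> convergent_fps"
  using fps_conv_radius_add[of F G] by (auto simp: min_def intro: less_le_trans split: if_splits)

lemma convergent_fps_diff: "F \<in> convergent_fps \<Longrightarrow> G \<in> convergent_fps \<Longrightarrow> F - G \<in> convergent_fps"
  using fps_conv_radius_diff[of F G] by (auto simp: min_def intro: less_le_trans split: if_splits)

lemma convergent_fps_mult: "F \<in> convergent_fps \<Longrightarrow> G \<in> convergent_fps \<Longrightarrow> F * G \<in> convergent_fps"
  using fps_conv_radius_mult[of F G] by (auto simp: min_def intro: less_le_trans split: if_splits)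

lemma convergent_fps_sum:
  assumes "\<And>i. i \<in> I \<Longrightarrow> F i \<in> convergent_fps"
  shows "(\<Sum>i\<in>I. F i) \<in> convergent_fps"
  using assms
proof (induction I rule: infinite_finite_induct)
  case (insert i I)
  thus ?case using convergent_fps_add[of "F i" "\<Sum>i\<in>I. F i"] by simp
qed auto

text \<open>At a positive \<open>w\<close> inside the disc of convergence, the terms of the new
  series at \<open>w ^ v\<close> are, up to the constant factor \<open>w ^ s\<close>, a subfamily of
  an absolutely summable family.\<close>

lemma convergent_fps_subseq:
  assumes F: "F \<in> convergent_fps" and v: "v > 0"
  shows "Abs_fps (\<lambda>n. F $ (s + v * n)) \<in> convergent_fps"
proof -
  obtain w :: real where w: "0 < w" "ereal w < fps_conv_radius F"
    using F ereal_dense2[of 0 "fps_conv_radius F"] by auto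
  have "summable (\<lambda>k. norm (F $ k * of_real w ^ k))"
    using abs_summable_in_conv_radius[of "of_real w :: complex" "fps_nth F"] w
    by (simp add: fps_conv_radius_def)
  hence "(\<lambda>k. norm (F $ k * of_real w ^ k)) summable_on UNIV"
    by (subst summable_on_UNIV_nonneg_real_iff) auto
  hence "(\<lambda>k. norm (F $ k * of_real w ^ k)) summable_on range (\<lambda>n. s + v * n)"
    by (rule summable_on_subset) auto
  hence "(\<lambda>n. norm (F $ (s + v * n) * of_real w ^ (s + v * n))) summable_on UNIV"
    using v by (subst (asm) summable_on_reindex) (auto simp: inj_on_def o_def)
  hence "(\<lambda>n. (1 / w ^ s) * norm (F $ (s + v * n) * of_real w ^ (s + v * n))) summable_on UNIV"
    by (rule summable_on_cmult_right)
  also have "(\<lambda>n. (1 / w ^ s) * norm (F $ (s + v * n) * of_real w ^ (s + v * n)))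
      = (\<lambda>n. norm (F $ (s + v * n) * of_real (w ^ v) ^ n))"
    using w by (auto simp: norm_mult norm_power power_add power_mult)
  finally have "summable (\<lambda>n. norm (F $ (s + v * n) * of_real (w ^ v) ^ n))"
    by (subst (asm) summable_on_UNIV_nonneg_real_iff) auto
  hence "summable (\<lambda>n. F $ (s + v * n) * of_real (w ^ v) ^ n)" by (rule summable_norm_cancel)
  hence "conv_radius (\<lambda>n. F $ (s + v * n)) \<ge> norm (of_real (w ^ v) :: complex)"
    by (rule conv_radius_geI)
  moreover have "norm (of_real (w ^ v) :: complex) > 0" using w by simp
  ultimately have "conv_radius (\<lambda>n. F $ (s + v * n)) > 0"
    by (metis ereal_less(2) less_le_trans)
  thus ?thesis by (simp add: fps_conv_radius_def)
qed

text \<open>Exponents are sorted by their residue modulo \<open>v\<close>; at the coefficient of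
  degree \<open>k\<close> only the summand \<open>s = k mod v\<close> contributes. So 1, t, ...,
  t^(v-1) generate over series in t^v.\<close>

lemma fps_residue_decomposition:
  fixes F :: "complex fps"
  assumes v: "v > 0"
  shows "F = (\<Sum>s<v. (Abs_fps (\<lambda>n. F $ (s + v * n)) oo fps_X ^ v) * fps_X ^ s)"
proof (rule fps_ext)
  fix k
  have "((Abs_fps (\<lambda>n. F $ (s + v * n)) oo fps_X ^ v) * fps_X ^ s) $ k = (if s = k mod v then F $ k else 0)"
    if s: "s < v" for s
  proof (cases "s = k mod v")
    case True
    hence *: "s \<le> k" "v dvd k - s" by (auto simp: minus_mod_eq_mult_div)
    moreover have "s + v * ((k - s) div v) = k" using * by simp
    moreover have "\<not> k < k mod v" by (simp add: not_less)
    ultimately show ?thesis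
      using True by (simp add: fps_X_power_mult_right_nth fps_nth_compose_X_power)
  next
    case False
    have "\<not> v dvd k - s" if "s \<le> k"
    proof
      assume "v dvd k - s"
      hence "k mod v = s mod v" using that by (metis mod_eq_dvd_iff_nat)
      thus False using s False by simp
    qed
    thus ?thesis using False by (auto simp: fps_X_power_mult_right_nth fps_nth_compose_X_power)
  qed
  hence "(\<Sum>s<v. ((Abs_fps (\<lambda>n. F $ (s + v * n)) oo fps_X ^ v) * fps_X ^ s) $ k)
       = (\<Sum>s<v. if s = k mod v then F $ k else 0)"
    by (intro sum.cong) auto
  also have "\<dots> = F $ k" using v by simp
  finally show "F $ k = (\<Sum>s<v. (Abs_fps (\<lambda>n. F $ (s + v * n)) oo fps_X ^ v) * fps_X ^ s) $ k"
    by (simp add: fps_sum_nth)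
qed

text \<open>The coefficients of the \<open>u i\<close> below degree \<open>v\<close> form a
  triangular matrix with nonzero diagonal: each new \<open>u v\<close> corrects degree
  \<open>v\<close> without disturbing the lower degrees.\<close>

lemma fps_triangular_elimination:
  fixes F :: "complex fps"
  assumes u: "\<And>i j. i < v \<Longrightarrow> j < i \<Longrightarrow> u i $ j = 0" "\<And>i. i < v \<Longrightarrow> u i $ i \<noteq> 0"
  shows "\<exists>c. \<forall>j<v. (F - (\<Sum>i<v. fps_const (c i) * u i)) $ j = 0"
  using assms
proof (induction v)
  case (Suc v)
  have "\<exists>c. \<forall>j<v. (F - (\<Sum>i<v. fps_const (c i) * u i)) $ j = 0"
    by (rule Suc.IH) (use Suc.prems in auto)
  then obtain c where c: "\<forall>j<v. (F - (\<Sum>i<v. fps_const (c i) * u i)) $ j = 0" by blast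
  define G where "G = F - (\<Sum>i<v. fps_const (c i) * u i)"
  define c' where "c' = c(v := G $ v / u v $ v)"
  have eq: "F - (\<Sum>i<Suc v. fps_const (c' i) * u i) = G - fps_const (G $ v / u v $ v) * u v"
    by (simp add: G_def c'_def)
  show ?case
  proof (intro exI[of _ c'] allI impI)
    fix j assume "j < Suc v"
    then consider "j < v" | "j = v" by linarith
    thus "(F - (\<Sum>i<Suc v. fps_const (c' i) * u i)) $ j = 0"
    proof cases
      case 1
      hence "G $ j = 0" "u v $ j = 0" using c Suc.prems(1)[of v j] unfolding G_def by blast+
      thus ?thesis unfolding eq by simp
    qed (unfold eq, use Suc.prems(2)[of v] in simp)
  qed
qed auto

text \<open>With \<open>x = t\<^sup>v\<close>, the ring \<open>\<complex>{t}\<close> is finite over \<open>\<complex>{x}\<close>; modulo \<open>x\<close> it is spanned by the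
  \<open>u\<^sub>0, \<dots>, u\<^sub>v\<^sub>-\<^sub>1\<close>, hence these generate it by Nakayama's lemma. This avoids any
  estimate for the convergence of successive cancellation of leading terms.\<close>

lemma convergent_fps_module_generators:
  assumes v: "v > 0" and uC: "\<And>i. i < v \<Longrightarrow> u i \<in> convergent_fps"
    and u: "\<And>i j. i < v \<Longrightarrow> j < i \<Longrightarrow> u i $ j = 0" "\<And>i. i < v \<Longrightarrow> u i $ i \<noteq> 0"
    and F: "F \<in> convergent_fps"
  shows "\<exists>A. (\<forall>i<v. A i \<in> convergent_fps) \<and> F = (\<Sum>i<v. (A i oo fps_X ^ v) * u i)"
proof -
  define R where "R = (\<lambda>A :: complex fps. A oo fps_X ^ v) ` convergent_fps"
  have X0: "(fps_X ^ v :: complex fps) $ 0 = 0" using v by simp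
  note mult_distrib = fps_compose_mult_distrib[OF X0]
  have RI: "A oo fps_X ^ v \<in> R" if "A \<in> convergent_fps" for A using that by (auto simp: R_def)
  interpret subsemiring R
  proof
    show "0 \<in> R" using RI[of 0] by simp
    show "a + b \<in> R" "a * b \<in> R" if ab: "a \<in> R" "b \<in> R" for a b
    proof -
      obtain A B where AB: "A \<in> convergent_fps" "B \<in> convergent_fps" "a = A oo fps_X ^ v" "b = B oo fps_X ^ v"
        using ab by (auto simp: R_def)
      show "a + b \<in> R" "a * b \<in> R"
        using RI[OF convergent_fps_add[OF AB(1,2)]] RI[OF convergent_fps_mult[OF AB(1,2)]]
        by (simp_all add: AB(3,4) fps_compose_add_distrib mult_distrib)
    qed
  qed
  \<comment> \<open>The wanted generators come first. The monomials 1, ..., t^(v-1) follow, as the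
    finite generating set that Nakayama's lemma presupposes and then removes; hence
    \<open>N = v + v\<close>.\<close>
  define g where "g i = (if i < v then u i else fps_X ^ (i - v))" for i
  have "convergent_fps \<subseteq> lin_span R g v"
  proof (rule nakayama[where N="v + v" and x="fps_X ^ v"])
    show "(fps_X ^ v :: complex fps) \<in> R"
      using RI[of fps_X] by (simp add: fps_X_fps_compose_startby0[OF X0])
    show "\<exists>r'\<in>R. r' * (1 - fps_X ^ v * r) = 1" if r: "r \<in> R" for r
    proof -
      obtain A where A: "A \<in> convergent_fps" "r = A oo fps_X ^ v" using r by (auto simp: R_def)
      \<comment> \<open>1 - t^v r is the series \<open>B\<close> evaluated at t^v. Its constant term
        is 1, so its inverse converges and lies again in the coefficient ring.\<close>
      define B where "B = 1 - fps_X * A"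
      have "B \<in> convergent_fps" unfolding B_def
        by (intro convergent_fps_diff convergent_fps_mult A) auto
      moreover have B0: "B $ 0 \<noteq> 0" by (simp add: B_def)
      ultimately have "inverse B oo fps_X ^ v \<in> R" by (intro RI) (simp add: fps_conv_radius_inverse_pos)
      moreover have "(inverse B oo fps_X ^ v) * (1 - fps_X ^ v * r) = (inverse B * B) oo fps_X ^ v"
        by (simp add: mult_distrib B_def fps_compose_sub_distrib A(2) fps_X_fps_compose_startby0[OF X0])
      moreover have "(inverse B * B) = 1" using B0 by (simp add: inverse_mult_eq_1)
      ultimately show ?thesis by (intro bexI[of _ "inverse B oo fps_X ^ v"]) simp_all
    qed
    show "g i \<in> convergent_fps" if "i < v + v" for i using uC by (auto simp: g_def)
    show "convergent_fps \<subseteq> lin_span R g (v + v)"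
    proof
      fix f assume f: "f \<in> convergent_fps"
      define r where "r i = (if i < v then 0 else Abs_fps (\<lambda>n. f $ ((i - v) + v * n)) oo fps_X ^ v)" for i
      have "r i \<in> R" for i
      proof (cases "i < v")
        case False
        hence "r i = Abs_fps (\<lambda>n. f $ ((i - v) + v * n)) oo fps_X ^ v" by (simp only: r_def if_False)
        thus ?thesis using RI[OF convergent_fps_subseq[OF f v, of "i - v"]] by (simp only:)
      qed (simp add: r_def zero)
      moreover have "f = (\<Sum>i<v+v. r i * g i)"
      proof -
        have "(\<Sum>i<v+v. r i * g i) = (\<Sum>i=0..<v. r i * g i) + (\<Sum>i=v..<v+v. r i * g i)"
          by (simp add: atLeast0LessThan[symmetric] sum.atLeastLessThan_concat)
        also have "(\<Sum>i=0..<v. r i * g i) = 0" by (simp add: r_def)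
        also have "(\<Sum>i=v..<v+v. r i * g i) = (\<Sum>i=0..<v. r (i + v) * g (i + v))"
          using sum.shift_bounds_nat_ivl[of "\<lambda>i. r i * g i" 0 v v] by simp
        also have "\<dots> = (\<Sum>s<v. (Abs_fps (\<lambda>n. f $ (s + v * n)) oo fps_X ^ v) * fps_X ^ s)"
          by (simp add: r_def g_def atLeast0LessThan)
        finally show ?thesis using fps_residue_decomposition[OF v, of f] by simp
      qed
      ultimately show "f \<in> lin_span R g (v + v)"
        unfolding lin_span_def by (intro CollectI exI[of _ r]) auto
    qed
    fix f assume f: "f \<in> convergent_fps"
    obtain c where c: "\<forall>j<v. (f - (\<Sum>i<v. fps_const (c i) * u i)) $ j = 0"
      using fps_triangular_elimination[OF u] by blast
    define a where "a = (\<Sum>i<v. fps_const (c i) * u i)"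
    \<comment> \<open>The elimination has removed all coefficients of \<open>f - a\<close> below
      degree \<open>v\<close>, so the shift is division by t^v.\<close>
    define f' where "f' = fps_shift v (f - a)"
    have cR: "fps_const z \<in> R" for z using RI[of "fps_const z"] by simp
    have "a \<in> lin_span R g v"
      unfolding lin_span_def a_def
      by (intro CollectI exI[of _ "\<lambda>i. fps_const (c i)"]) (simp add: cR g_def)
    moreover have aC: "a \<in> convergent_fps"
      unfolding a_def by (intro convergent_fps_sum convergent_fps_mult) (use uC in auto)
    moreover have "f' \<in> convergent_fps" using convergent_fps_diff[OF f aC] by (simp add: f'_def)
    moreover have "f = a + fps_X ^ v * f'"
    proof -
      have "fps_X ^ v * f' = f - a"
      proof (rule fps_ext)
        fix k show "(fps_X ^ v * f') $ k = (f - a) $ k"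
          using c[folded a_def] by (cases "k < v") (simp_all add: f'_def fps_X_power_mult_nth del: fps_sub_nth)
      qed
      thus ?thesis by simp
    qed
    ultimately show "\<exists>a\<in>lin_span R g v. \<exists>f'\<in>convergent_fps. f = a + fps_X ^ v * f'"
      by (intro bexI[of _ a] bexI[of _ f'])
  qed simp
  then obtain r where r: "\<forall>i<v. r i \<in> R" "F = (\<Sum>i<v. r i * g i)" using F by (auto simp: lin_span_def)
  have "\<forall>i. \<exists>A. i < v \<longrightarrow> A \<in> convergent_fps \<and> r i = A oo fps_X ^ v"
    using r(1) by (auto simp: R_def)
  from choice[OF this] obtain A where A: "\<And>i. i < v \<Longrightarrow> A i \<in> convergent_fps"
    "\<And>i. i < v \<Longrightarrow> r i = A i oo fps_X ^ v" by blast
  have "(\<Sum>i<v. r i * g i) = (\<Sum>i<v. (A i oo fps_X ^ v) * u i)"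
    by (rule sum.cong) (simp_all add: A(2) g_def)
  thus ?thesis using A(1) r(2) by blast
qed

section \<open>Orders of germs and limits of quotients by powers of t\<close>

lemma ord0_conv_subdegree:
  assumes "f has_fps_expansion F"
  shows "ord0 f = (if F = 0 then \<infinity> else enat (subdegree F))"
proof (cases "F = 0")
  case True
  thus ?thesis using assms by (simp add: ord0_def has_fps_expansion_0_iff)
next
  case False
  have "\<not> (\<forall>\<^sub>F t in nhds 0. f t = 0)"
  proof
    assume "\<forall>\<^sub>F t in nhds 0. f t = 0"
    hence "f has_fps_expansion 0" by (simp add: has_fps_expansion_0_iff)
    from fps_expansion_unique_complex[OF assms this] False show False by simp
  qed
  thus ?thesis using False has_fps_expansion_zorder_0[OF assms False] by (simp add: ord0_def)
qed

lemma ord0_fps_nth_eq_0: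
  assumes "f has_fps_expansion F" "enat k < ord0 f" "j \<le> k"
  shows "F $ j = 0"
proof (cases "F = 0")
  case False
  hence "j < subdegree F" using assms(2,3) by (simp add: ord0_conv_subdegree[OF assms(1)])
  thus ?thesis by (rule nth_less_subdegree_zero)
qed simp

lemma has_fps_expansion_eventually_eq:
  assumes "f has_fps_expansion F" "g has_fps_expansion F"
  shows "\<forall>\<^sub>F t in nhds 0. f t = g t"
proof -
  note assms[unfolded has_fps_expansion_def, THEN conjunct2]
  thus ?thesis by eventually_elim metis
qed

lemma fps_expansion_div_power_tendsto:
  fixes f :: "complex \<Rightarrow> complex"
  assumes f: "f has_fps_expansion F" and F: "\<And>j. j < k \<Longrightarrow> F $ j = 0"
  shows "((\<lambda>t. f t / t ^ k) \<longlongrightarrow> F $ k) (at 0)"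
proof -
  have Feq: "fps_shift k F * fps_X ^ k = F"
    by (rule fps_ext) (use F in \<open>auto simp: fps_X_power_mult_right_nth\<close>)
  have C: "fps_conv_radius (fps_shift k F) > 0" using f by (simp add: has_fps_expansion_def)
  have "(\<lambda>t. eval_fps (fps_shift k F) t * t ^ k) has_fps_expansion fps_shift k F * fps_X ^ k"
    by (intro has_fps_expansion_mult has_fps_expansion_fps_X_power eval_fps_has_fps_expansion C)
  from has_fps_expansion_eventually_eq[OF f this[unfolded Feq]]
  have "\<forall>\<^sub>F t in nhds 0. f t = eval_fps (fps_shift k F) t * t ^ k" .
  hence "\<forall>\<^sub>F t in at 0. eval_fps (fps_shift k F) t = f t / t ^ k"
    unfolding eventually_at_filter by eventually_elim auto
  moreover have "(eval_fps (fps_shift k F) \<longlongrightarrow> F $ k) (at 0)"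
    using has_fps_expansion_imp_continuous[OF eval_fps_has_fps_expansion[OF C], of UNIV]
    by (simp add: continuous_within eval_fps_at_0)
  ultimately show ?thesis by (rule Lim_transform_eventually[rotated])
qed

text \<open>Reads an order off a limit, so that orders of composed germs can be found by asymptotics
  instead of by manipulating their expansions.\<close>

lemma ord0_eq_of_tendsto:
  assumes f: "f analytic_on {0}" and lim: "((\<lambda>t. f t / t ^ k) \<longlongrightarrow> L) (at 0)" and L: "L \<noteq> 0"
  shows "ord0 f = enat k"
proof -
  obtain F where F: "f has_fps_expansion F" using analytic_at_imp_has_fps_expansion_0[OF f] by blast
  have nz: "F \<noteq> 0"
  proof
    assume "F = 0"
    hence "\<forall>\<^sub>F t in nhds 0. f t = 0" using F by (simp add: has_fps_expansion_0_iff)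
    hence "\<forall>\<^sub>F t in at 0. 0 = f t / t ^ k" unfolding eventually_at_filter by eventually_elim simp
    hence "((\<lambda>t. f t / t ^ k) \<longlongrightarrow> 0) (at 0)"
      by (rule Lim_transform_eventually[OF tendsto_const])
    from tendsto_unique[OF at_neq_bot this lim] show False using L by simp
  qed
  define d where "d = subdegree F"
  have d: "((\<lambda>t. f t / t ^ d) \<longlongrightarrow> F $ d) (at 0)"
    by (rule fps_expansion_div_power_tendsto[OF F]) (unfold d_def, rule nth_less_subdegree_zero)
  have Fd: "F $ d \<noteq> 0" unfolding d_def using nz by (rule nth_subdegree_nonzero)
  have "d = k"
  proof (rule ccontr)
    assume "d \<noteq> k"
    \<comment> \<open>A finite limit for the larger exponent \<open>q\<close> forces the limit for
      \<open>p\<close> to be zero, because the quotients differ by the factor t^(q-p).\<close>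
    have no: False if p: "p < q" and 1: "((\<lambda>t. f t / t ^ p) \<longlongrightarrow> A) (at 0)" and
      2: "((\<lambda>t. f t / t ^ q) \<longlongrightarrow> B) (at 0)" and A: "A \<noteq> 0" for p q A B
    proof -
      have "((\<lambda>t. f t / t ^ q * t ^ (q - p)) \<longlongrightarrow> B * 0 ^ (q - p)) (at 0)"
        by (intro tendsto_mult 2 tendsto_power tendsto_ident_at)
      hence "((\<lambda>t. f t / t ^ p) \<longlongrightarrow> B * 0 ^ (q - p)) (at 0)"
      proof (rule Lim_transform_eventually)
        show "\<forall>\<^sub>F t in at 0. f t / t ^ q * t ^ (q - p) = f t / t ^ p"
          unfolding eventually_at_filter
        proof (intro always_eventually allI impI)
          fix t :: complex assume t: "t \<noteq> 0"
          have "t ^ q = t ^ p * t ^ (q - p)" using p by (subst power_add[symmetric]) simp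
          with t show "f t / t ^ q * t ^ (q - p) = f t / t ^ p" by simp
        qed
      qed
      from tendsto_unique[OF at_neq_bot this 1] show False using p A by (simp add: zero_power)
    qed
    from \<open>d \<noteq> k\<close> consider "d < k" | "k < d" by linarith
    thus False
      by cases (rule no[OF _ d lim Fd], assumption, rule no[OF _ lim d L], assumption)
  qed
  with nz show ?thesis by (simp add: ord0_conv_subdegree[OF F] d_def)
qed

section \<open>Truncation of parametrizations\<close>

text \<open>The Weierstrass M-test along the net of finite sets of multi-indices: the remainder at
  every \<open>t\<close> is bounded by the same remainder of the numerical series
  \<open>N\<close>.\<close>

lemma uniform_limit_series_bound:
  assumes a: "series_bound m R M a g" and x: "\<And>t. t \<in> T \<Longrightarrow> polydisc m R (x t)"
  shows "uniform_limit T (\<lambda>X t. \<Sum>\<alpha>\<in>X. a \<alpha> * mon m \<alpha> (x t)) (\<lambda>t. g (x t)) (finite_subsets_at_top (multi_indices m))"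
proof (rule uniform_limitI)
  fix e :: real assume e: "e > 0"
  define N where "N \<alpha> = norm (a \<alpha>) * R ^ deg m \<alpha>" for \<alpha>
  define S where "S = infsum N (multi_indices m)"
  have N: "(N has_sum S) (multi_indices m)"
    using a by (simp add: series_bound_def N_def[abs_def] S_def)
  have "\<forall>\<^sub>F X in finite_subsets_at_top (multi_indices m). dist (sum N X) S < e"
    using N e unfolding has_sum_def by (rule tendstoD)
  moreover have "\<forall>\<^sub>F X in finite_subsets_at_top (multi_indices m). finite X \<and> X \<subseteq> multi_indices m"
    by (rule eventually_finite_subsets_at_top_weakI) simp
  ultimately show "\<forall>\<^sub>F X in finite_subsets_at_top (multi_indices m).
      \<forall>t\<in>T. dist (\<Sum>\<alpha>\<in>X. a \<alpha> * mon m \<alpha> (x t)) (g (x t)) < e"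
  proof eventually_elim
    case (elim X)
    show ?case
    proof
      fix t assume t: "t \<in> T"
      have "((\<lambda>\<alpha>. a \<alpha> * mon m \<alpha> (x t)) has_sum g (x t)) (multi_indices m)"
        using a x[OF t] by (simp add: series_bound_def)
      hence "((\<lambda>\<alpha>. a \<alpha> * mon m \<alpha> (x t)) has_sum g (x t) - (\<Sum>\<alpha>\<in>X. a \<alpha> * mon m \<alpha> (x t))) (multi_indices m - X)"
        using elim by (intro has_sum_Diff has_sum_finite) auto
      moreover have "(N has_sum S - sum N X) (multi_indices m - X)"
        using elim by (intro has_sum_Diff has_sum_finite N) auto
      ultimately have "norm (g (x t) - (\<Sum>\<alpha>\<in>X. a \<alpha> * mon m \<alpha> (x t))) \<le> S - sum N X"
        by (rule norm_infsum_le) (auto simp: N_def norm_mult intro!: mult_left_mono norm_mon_le x[OF t])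
      also have "\<dots> < e" using elim by (simp add: dist_real_def)
      finally show "dist (\<Sum>\<alpha>\<in>X. a \<alpha> * mon m \<alpha> (x t)) (g (x t)) < e"
        by (simp add: dist_norm norm_minus_commute)
    qed
  qed
qed

lemma analytic_germs_common_ball:
  assumes "R > 0" and "\<And>i. i < (m::nat) \<Longrightarrow> (\<lambda>t. \<phi> t i) analytic_on {0} \<and> \<phi> 0 i = 0"
  obtains \<rho> where "\<rho> > 0" "\<And>i. i < m \<Longrightarrow> (\<lambda>t. \<phi> t i) holomorphic_on cball 0 \<rho>"
    "\<And>i t. i < m \<Longrightarrow> t \<in> cball 0 \<rho> \<Longrightarrow> norm (\<phi> t i :: complex) \<le> R"
proof -
  have "\<exists>e>0. (\<lambda>t. \<phi> t i) holomorphic_on ball 0 e \<and> (\<forall>t\<in>ball 0 e. norm (\<phi> t i) \<le> R)" if i: "i < m" for i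
  proof -
    obtain e where e: "e > 0" "(\<lambda>t. \<phi> t i) holomorphic_on ball 0 e"
      using assms(2)[OF i] by (auto simp: analytic_on_def)
    have "isCont (\<lambda>t. \<phi> t i) 0"
      using assms(2)[OF i] analytic_at_imp_isCont by blast
    hence "((\<lambda>t. \<phi> t i) \<longlongrightarrow> \<phi> 0 i) (nhds 0)"
      unfolding isCont_def using tendsto_at_iff_tendsto_nhds[of "\<lambda>t. \<phi> t i" 0] by simp
    hence "\<forall>\<^sub>F t in nhds 0. dist (\<phi> t i) (\<phi> 0 i) < R" using assms(1) by (rule tendstoD)
    then obtain e' where e': "e' > 0" "\<And>t. dist t 0 < e' \<Longrightarrow> dist (\<phi> t i) (\<phi> 0 i) < R"
      unfolding eventually_nhds_metric by blast
    show ?thesis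
    proof (intro exI[of _ "min e e'"] conjI ballI)
      show "(\<lambda>t. \<phi> t i) holomorphic_on ball 0 (min e e')"
        by (rule holomorphic_on_subset[OF e(2)]) auto
      show "norm (\<phi> t i) \<le> R" if "t \<in> ball 0 (min e e')" for t
        using e'(2)[of t] that assms(2)[OF i] by (simp add: dist_norm)
    qed (use e e' in auto)
  qed
  hence "\<forall>i. \<exists>e. i < m \<longrightarrow>
      e > 0 \<and> (\<lambda>t. \<phi> t i) holomorphic_on ball 0 e \<and> (\<forall>t\<in>ball 0 e. norm (\<phi> t i) \<le> R)" by blast
  from choice[OF this] obtain E where E: "\<And>i. i < m \<Longrightarrow> E i > 0"
    "\<And>i. i < m \<Longrightarrow> (\<lambda>t. \<phi> t i) holomorphic_on ball 0 (E i)"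
    "\<And>i t. i < m \<Longrightarrow> t \<in> ball 0 (E i) \<Longrightarrow> norm (\<phi> t i) \<le> R"
    by blast
  define \<mu> where "\<mu> = Min (insert 1 (E ` {..<m}))"
  \<comment> \<open>Halving places the closed disc inside all the open ones; uniform limits need
    continuity up to the boundary.\<close>
  define \<rho> where "\<rho> = \<mu> / 2"
  have "\<mu> > 0" using E(1) by (auto simp: \<mu>_def)
  hence \<rho>: "\<rho> > 0" by (simp add: \<rho>_def)
  have sub: "cball 0 \<rho> \<subseteq> ball (0::complex) (E i)" if "i < m" for i
  proof -
    have "\<mu> \<le> E i" using that unfolding \<mu>_def by (intro Min_le) auto
    hence "\<rho> < E i" using \<rho> by (simp add: \<rho>_def)
    thus ?thesis by (simp add: cball_subset_ball_iff)
  qed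
  show ?thesis
  proof (rule that[OF \<rho>])
    show "(\<lambda>t. \<phi> t i) holomorphic_on cball 0 \<rho>" if "i < m" for i
      using holomorphic_on_subset[OF E(2) sub] that by blast
    show "norm (\<phi> t i) \<le> R" if "i < m" "t \<in> cball 0 \<rho>" for i t
      using E(3) sub that by blast
  qed
qed

text \<open>The partial sums are polynomials in the components of the curve, hence holomorphic on a
  common disc, and they converge uniformly there.\<close>

lemma convergent_series_compose_analytic:
  assumes g: "g \<in> convergent_series m"
    and \<phi>: "\<And>i. i < m \<Longrightarrow> (\<lambda>t. \<phi> t i) analytic_on {0} \<and> \<phi> 0 i = 0"
  shows "(\<lambda>t. g (\<phi> t)) analytic_on {0}"
proof -
  obtain R M a where R: "R > 0" and a: "series_bound m R M a g"
    using g by (auto simp: convergent_series_iff_majorized majorized_def)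
  show ?thesis
  proof (rule analytic_germs_common_ball[of R m \<phi>, OF R \<phi>])
    fix \<rho> :: real assume \<rho>: "\<rho> > 0" and hol: "\<And>i. i < m \<Longrightarrow> (\<lambda>t. \<phi> t i) holomorphic_on cball 0 \<rho>"
      and bd: "\<And>i t. i < m \<Longrightarrow> t \<in> cball 0 \<rho> \<Longrightarrow> norm (\<phi> t i) \<le> R"
    let ?F = "finite_subsets_at_top (multi_indices m)"
    have ulim: "uniform_limit (cball 0 \<rho>) (\<lambda>X t. \<Sum>\<alpha>\<in>X. a \<alpha> * mon m \<alpha> (\<phi> t)) (\<lambda>t. g (\<phi> t)) ?F"
      by (rule uniform_limit_series_bound[OF a]) (use bd in blast)
    have holX: "(\<lambda>t. \<Sum>\<alpha>\<in>X. a \<alpha> * mon m \<alpha> (\<phi> t)) holomorphic_on cball 0 \<rho>" for X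
      unfolding mon_def by (intro holomorphic_intros hol) auto
    have "(\<lambda>t. g (\<phi> t)) holomorphic_on ball 0 \<rho>"
    proof (rule holomorphic_uniform_limit[OF _ ulim])
      show "\<forall>\<^sub>F X in ?F. continuous_on (cball 0 \<rho>) (\<lambda>t. \<Sum>\<alpha>\<in>X. a \<alpha> * mon m \<alpha> (\<phi> t))
          \<and> (\<lambda>t. \<Sum>\<alpha>\<in>X. a \<alpha> * mon m \<alpha> (\<phi> t)) holomorphic_on ball 0 \<rho>"
        by (rule always_eventually, rule allI, rule conjI)
           (rule holomorphic_on_imp_continuous_on[OF holX], rule holomorphic_on_subset[OF holX ball_subset_cball])
    qed simp_all
    thus "(\<lambda>t. g (\<phi> t)) analytic_on {0}"
      using \<rho> unfolding analytic_at by (intro exI[of _ "ball 0 \<rho>"]) simp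
  qed
qed

lemma convergent_series_eval_fps:
  assumes A: "A \<in> convergent_fps" and m: "0 < m"
  shows "(\<lambda>x. eval_fps A (x 0)) \<in> convergent_series m"
proof -
  obtain r :: real where r: "0 < r" "ereal r < fps_conv_radius A"
    using A ereal_dense2[of 0 "fps_conv_radius A"] by auto
  have abs: "summable (\<lambda>k. norm (fps_nth A k * z ^ k))" if "norm z \<le> r" for z
  proof (rule abs_summable_in_conv_radius)
    have "ereal (norm z) \<le> ereal r" using that by simp
    thus "ereal (norm z) < conv_radius (fps_nth A)"
      using r(2) unfolding fps_conv_radius_def by (rule le_less_trans)
  qed
  have N: "(\<lambda>k. norm (fps_nth A k) * r ^ k) summable_on UNIV"
    using abs[of "of_real r"] r by (subst summable_on_UNIV_nonneg_real_iff) (auto simp: norm_mult norm_power)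
  have "majorized m r (\<Sum>\<^sub>\<infinity>k. norm (fps_nth A k) * r ^ k) (\<lambda>x. eval_fps A (x 0))"
  proof (rule majorized_infsum[OF r(1), where I=UNIV and h="\<lambda>k x. fps_nth A k * x 0 ^ k"])
    show "majorized m r (norm (fps_nth A k) * r ^ k) (\<lambda>x. fps_nth A k * x 0 ^ k)" for k
      by (intro majorized_cmult majorized_power majorized_coord r(1) m)
    show "((\<lambda>k. fps_nth A k * x 0 ^ k) has_sum eval_fps A (x 0)) UNIV" if "polydisc m r x" for x
    proof -
      have x0: "norm (x 0) \<le> r" using that m by blast
      show ?thesis
        unfolding eval_fps_def
        by (rule norm_summable_imp_has_sum[OF abs[OF x0] summable_sums[OF summable_norm_cancel[OF abs[OF x0]]]])
    qed
  qed (use N in auto)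
  thus ?thesis using r by (auto simp: convergent_series_iff_majorized)
qed

text \<open>Pullbacks of orders c, ..., c + v - 1, divided by t^c, have orders 0, ..., v - 1 and so
  generate all convergent series over those in t^v. The coefficients are pullbacks too: since the
  first component is t^v, a series in t^v is a series in \<open>x 0\<close> restricted to the curve.
  Multiplying back by t^c represents \<open>f\<close>.\<close>

lemma pullback_surjective_above_conductor:
  assumes \<phi>: "curve_germ m \<phi>" and m: "0 < m" and v: "v > 0"
    and \<phi>0: "\<forall>\<^sub>F t in nhds 0. \<phi> t 0 = t ^ v"
    and \<Gamma>: "\<And>k. k \<ge> c \<Longrightarrow> k \<in> value_semigroup m \<phi>"
    and f: "f has_fps_expansion F" and Fc: "\<And>j. j < c \<Longrightarrow> fps_nth F j = 0"
  obtains g where "g \<in> convergent_series m" "\<forall>\<^sub>F t in nhds 0. g (\<phi> t) = f t"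
proof -
  have \<phi>': "(\<lambda>t. \<phi> t i) analytic_on {0} \<and> \<phi> 0 i = 0" if "i < m" for i
    using \<phi> that by (simp add: curve_germ_def)
  have "\<exists>h. h \<in> convergent_series m \<and> ord0 (\<lambda>t. h (\<phi> t)) = enat (c + i)" for i
    using \<Gamma>[of "c + i"] by (auto simp: value_semigroup_def)
  then obtain h where h: "\<And>i. h i \<in> convergent_series m" "\<And>i. ord0 (\<lambda>t. h i (\<phi> t)) = enat (c + i)"
    by metis
  define H where "H i = fps_expansion (\<lambda>t. h i (\<phi> t)) 0" for i
  have H: "(\<lambda>t. h i (\<phi> t)) has_fps_expansion H i" for i
    unfolding H_def by (intro analytic_at_imp_has_fps_expansion_0 convergent_series_compose_analytic[OF h(1)] \<phi>')
  have Hsub: "subdegree (H i) = c + i" "H i \<noteq> 0" for i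
    using h(2)[of i] unfolding ord0_conv_subdegree[OF H] by (auto split: if_splits)
  define u where "u i = fps_shift c (H i)" for i
  have Hu: "H i = u i * fps_X ^ c" for i
    unfolding u_def by (rule fps_shift_times_fps_X_power[symmetric]) (simp add: Hsub)
  have Fu: "fps_shift c F * fps_X ^ c = F"
    by (rule fps_ext) (use Fc in \<open>auto simp: fps_X_power_mult_right_nth\<close>)
  have "\<exists>A. (\<forall>i<v. A i \<in> convergent_fps) \<and> fps_shift c F = (\<Sum>i<v. (A i oo fps_X ^ v) * u i)"
  proof (rule convergent_fps_module_generators[OF v])
    show "u i \<in> convergent_fps" for i using H[of i] by (simp add: u_def has_fps_expansion_def)
    show "fps_nth (u i) j = 0" if "j < i" for i j
      unfolding u_def fps_shift_nth by (rule nth_less_subdegree_zero) (use that in \<open>simp add: Hsub\<close>)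
    show "fps_nth (u i) i \<noteq> 0" for i
      using nth_subdegree_nonzero[OF Hsub(2)[of i]] by (simp add: u_def Hsub(1) add.commute)
    show "fps_shift c F \<in> convergent_fps" using f by (simp add: has_fps_expansion_def)
  qed
  then obtain A where A: "\<And>i. i < v \<Longrightarrow> A i \<in> convergent_fps"
    and FA: "fps_shift c F = (\<Sum>i<v. (A i oo fps_X ^ v) * u i)" by blast
  define g where "g x = (\<Sum>i<v. eval_fps (A i) (x 0) * h i x)" for x
  have "g \<in> convergent_series m"
    unfolding g_def[abs_def]
    by (intro convergent_series_sum convergent_series_mult convergent_series_eval_fps h m A) auto
  moreover have "\<forall>\<^sub>F t in nhds 0. g (\<phi> t) = f t"
  proof -
    have "(\<lambda>t. \<Sum>i<v. (eval_fps (A i) \<circ> (\<lambda>t. t ^ v)) t * h i (\<phi> t)) has_fps_expansion (\<Sum>i<v. (A i oo fps_X ^ v) * H i)"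
      using A v by (intro has_fps_expansion_sum has_fps_expansion_mult H has_fps_expansion_compose
          eval_fps_has_fps_expansion has_fps_expansion_fps_X_power) auto
    moreover have "(\<Sum>i<v. (A i oo fps_X ^ v) * H i) = F"
      unfolding Hu using Fu unfolding FA by (simp add: sum_distrib_right mult.assoc)
    ultimately have "(\<lambda>t. \<Sum>i<v. eval_fps (A i) (t ^ v) * h i (\<phi> t)) has_fps_expansion F" by simp
    from has_fps_expansion_eventually_eq[OF this f] \<phi>0 show ?thesis
      by eventually_elim (simp add: g_def)
  qed
  ultimately show ?thesis by (rule that)
qed

section \<open>The linear part of a series vanishing to high order along the curve\<close>

lemma convergent_series_truncate:
  assumes "g \<in> convergent_series m"
  shows "(\<lambda>x. g (\<lambda>k. if k < j then x k else 0)) \<in> convergent_series j"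
proof -
  obtain r M where r: "r > 0" "majorized m r M g" using assms by (auto simp: convergent_series_iff_majorized)
  have "majorized j r M (\<lambda>x. g (\<lambda>k. if k < j then x k else 0))"
  proof (rule majorized_compose[OF r])
    show "majorized j r r (\<lambda>x. if k < j then x k else 0)" for k
      using r(1) by (cases "k < j") (auto intro: majorized_coord majorized_const)
  qed
  thus ?thesis using r by (auto simp: convergent_series_iff_majorized)
qed

text \<open>If \<open>g(\<phi>)\<close> vanishes to order greater than \<open>w\<^sub>i\<close>, the linear part of \<open>g\<close> involves only the
  coordinates beyond \<open>i\<close>: otherwise truncating \<open>g\<close> to the first \<open>j\<close> coordinates would
  exhibit \<open>w\<^sub>j\<close> as an element of \<open>\<Gamma>\<^sub>j\<close>.\<close>

lemma linear_part_triangular: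
  assumes \<phi>: "curve_germ m \<phi>" and W0: "W 0 > 0"
    and W: "\<And>j k. j < k \<Longrightarrow> k < m \<Longrightarrow> W j < W k"
    and lead: "\<And>k. k < m \<Longrightarrow> ((\<lambda>t. \<phi> t k / t ^ W k) \<longlongrightarrow> 1) (at 0)"
    and gap: "\<And>j. 0 < j \<Longrightarrow> j < m \<Longrightarrow> W j \<notin> value_semigroup j \<phi>"
    and g: "g \<in> convergent_series m" "g (\<lambda>_. 0) = 0"
    and q: "superlinear m (\<lambda>x. g x - (\<Sum>k<m. l k * x k))"
    and i: "i < m" and lim: "((\<lambda>t. g (\<phi> t) / t ^ W i) \<longlongrightarrow> 0) (at 0)"
    and j: "j \<le> i"
  shows "l j = 0"
proof -
  define q where "q x = g x - (\<Sum>k<m. l k * x k)" for x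
  define tr where "tr x = (\<lambda>k. if k < j then x k else 0)" for x :: "nat \<Rightarrow> complex"
  define h where "h x = g (tr x)" for x
  have jm: "j < m" using i j by simp
  have \<phi>': "(\<lambda>t. \<phi> t k) analytic_on {0} \<and> \<phi> 0 k = 0" if "k < m" for k
    using \<phi> that by (simp add: curve_germ_def)
  have \<phi>lim: "((\<lambda>t. \<phi> t k) \<longlongrightarrow> 0) (at 0)" if "k < m" for k
    using analytic_at_imp_isCont[of "\<lambda>t. \<phi> t k" 0] \<phi>'[OF that] by (simp add: isCont_def)
  have pow: "((\<lambda>t. f t / t ^ p) \<longlongrightarrow> L * 0 ^ (p' - p)) (at 0)"
    if "p \<le> p'" "((\<lambda>t. f t / t ^ p') \<longlongrightarrow> L) (at 0)" for f :: "complex \<Rightarrow> complex" and p p' L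
  proof (rule Lim_transform_eventually)
    show "((\<lambda>t. f t / t ^ p' * t ^ (p' - p)) \<longlongrightarrow> L * 0 ^ (p' - p)) (at 0)"
      by (intro tendsto_mult that tendsto_power tendsto_ident_at)
    show "\<forall>\<^sub>F t in at 0. f t / t ^ p' * t ^ (p' - p) = f t / t ^ p"
      unfolding eventually_at_filter
    proof (intro always_eventually allI impI)
      fix t :: complex assume t: "t \<noteq> 0"
      have "t ^ p' = t ^ p * t ^ (p' - p)" using that(1) by (subst power_add[symmetric]) simp
      with t show "f t / t ^ p' * t ^ (p' - p) = f t / t ^ p" by simp
    qed
  qed
  \<comment> \<open>Truncation discards the coordinates from \<open>j\<close> on. Measured against
    \<open>t ^ W j\<close>, only the j-th of these has a nonzero limit, as \<open>W\<close> is
    strictly increasing.\<close>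
  have ratio: "((\<lambda>t. (\<phi> t k - tr (\<phi> t) k) / t ^ W j) \<longlongrightarrow> (if k = j then 1 else 0)) (at 0)" if k: "k < m" for k
  proof -
    consider "k < j" | "k = j" | "k > j" by linarith
    thus ?thesis
    proof cases
      case 3
      hence "((\<lambda>t. \<phi> t k / t ^ W j) \<longlongrightarrow> 1 * 0 ^ (W k - W j)) (at 0)"
        using W[OF 3 k] by (intro pow lead k) simp
      thus ?thesis using 3 W[OF 3 k] by (simp add: tr_def zero_power)
    qed (use lead[OF k] in \<open>simp_all add: tr_def\<close>)
  qed
  have gj: "((\<lambda>t. g (\<phi> t) / t ^ W j) \<longlongrightarrow> 0) (at 0)"
  proof -
    have "W j \<le> W i" using W[of j i] i j by (cases "j = i") auto
    from pow[OF this lim] show ?thesis by simp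
  qed
  \<comment> \<open>Truncation moves each coordinate of the curve by at most 2 |t|^(W j), the limits
    in \<open>ratio\<close> being 0 or 1. A Lipschitz constant \<open>e / 4\<close> therefore leaves
    a quotient of at most \<open>e / 2\<close>.\<close>
  have qlim: "((\<lambda>t. (q (\<phi> t) - q (tr (\<phi> t))) / t ^ W j) \<longlongrightarrow> 0) (at 0)"
  proof (rule tendstoI)
    fix e :: real assume e: "e > 0"
    have "e / 4 > 0" using e by simp
    then obtain s where s: "s > 0" "lipschitz_germ m s (e / 4) q"
      using q unfolding superlinear_def q_def[abs_def] by blast
    have "\<forall>\<^sub>F t in at 0. \<forall>k\<in>{..<m}. dist (\<phi> t k) 0 < s"
      by (rule eventually_ball_finite, simp, rule ballI, rule tendstoD[OF \<phi>lim s(1)], simp)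
    moreover have "\<forall>\<^sub>F t in at 0. \<forall>k\<in>{..<m}. dist ((\<phi> t k - tr (\<phi> t) k) / t ^ W j) (if k = j then 1 else 0) < 1"
      by (rule eventually_ball_finite, simp, rule ballI, rule tendstoD[OF ratio zero_less_one], simp)
    moreover have "\<forall>\<^sub>F t in at 0. t \<noteq> (0 :: complex)" by (simp add: eventually_at_filter)
    ultimately show "\<forall>\<^sub>F t in at 0. dist ((q (\<phi> t) - q (tr (\<phi> t))) / t ^ W j) 0 < e"
    proof eventually_elim
      case (elim t)
      have "norm (q (\<phi> t) - q (tr (\<phi> t))) \<le> e / 4 * (2 * norm (t ^ W j))"
      proof (rule lipschitz_germ_pointwise[OF s(2)])
        show "polydisc m s (\<phi> t)" using elim(1) by (auto intro: less_imp_le)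
        show "polydisc m s (tr (\<phi> t))" using elim(1) s(1) by (auto simp: tr_def intro: less_imp_le)
        fix k assume k: "k < m"
        have "norm ((\<phi> t k - tr (\<phi> t) k) / t ^ W j) \<le> dist ((\<phi> t k - tr (\<phi> t) k) / t ^ W j) (if k = j then 1 else 0)
            + norm (if k = j then 1 else 0 :: complex)"
          unfolding dist_norm using norm_triangle_sub add.commute by metis
        also have "\<dots> \<le> 1 + 1"
        proof (rule add_mono)
          have "dist ((\<phi> t k - tr (\<phi> t) k) / t ^ W j) (if k = j then 1 else 0) < 1"
            using elim(2) k by blast
          thus "dist ((\<phi> t k - tr (\<phi> t) k) / t ^ W j) (if k = j then 1 else 0) \<le> 1"
            by (rule less_imp_le)
        qed simp
        finally show "norm (\<phi> t k - tr (\<phi> t) k) \<le> 2 * norm (t ^ W j)"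
          using elim(3) by (simp add: norm_divide divide_le_eq)
      qed simp
      moreover have "norm (t ^ W j) > 0" using elim(3) by simp
      ultimately have "norm (q (\<phi> t) - q (tr (\<phi> t))) / norm (t ^ W j) \<le> e / 2"
        by (simp add: divide_le_eq)
      also have "\<dots> < e" using e by simp
      finally show ?case by (simp add: norm_divide)
    qed
  qed
  \<comment> \<open>The truncated series equals \<open>g\<close> minus the linear and superlinear
    changes caused by truncation. After division by \<open>t ^ W j\<close> only the linear change
    survives in the limit, with value \<open>l j\<close>.\<close>
  have "((\<lambda>t. g (\<phi> t) / t ^ W j - (\<Sum>k<m. l k * ((\<phi> t k - tr (\<phi> t) k) / t ^ W j))
       - (q (\<phi> t) - q (tr (\<phi> t))) / t ^ W j) \<longlongrightarrow> 0 - (\<Sum>k<m. l k * (if k = j then 1 else 0)) - 0) (at 0)"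
    by (intro tendsto_diff gj qlim tendsto_sum tendsto_mult tendsto_const ratio) auto
  also have "(\<Sum>k<m. l k * (if k = j then 1 else 0)) = (\<Sum>k<m. if k = j then l j else 0)"
    by (rule sum.cong) auto
  also have "0 - \<dots> - 0 = - l j" using jm by simp
  also have "(\<lambda>t. g (\<phi> t) / t ^ W j - (\<Sum>k<m. l k * ((\<phi> t k - tr (\<phi> t) k) / t ^ W j))
       - (q (\<phi> t) - q (tr (\<phi> t))) / t ^ W j) = (\<lambda>t. h (\<phi> t) / t ^ W j)"
  proof
    fix t
    have "(\<Sum>k<m. l k * ((\<phi> t k - tr (\<phi> t) k) / t ^ W j))
        = ((\<Sum>k<m. l k * \<phi> t k) - (\<Sum>k<m. l k * tr (\<phi> t) k)) / t ^ W j"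
      by (simp add: sum_subtractf[symmetric] right_diff_distrib sum_divide_distrib)
    thus "g (\<phi> t) / t ^ W j - (\<Sum>k<m. l k * ((\<phi> t k - tr (\<phi> t) k) / t ^ W j))
       - (q (\<phi> t) - q (tr (\<phi> t))) / t ^ W j = h (\<phi> t) / t ^ W j"
      by (simp add: q_def h_def diff_divide_distrib)
  qed
  finally have hlim: "((\<lambda>t. h (\<phi> t) / t ^ W j) \<longlongrightarrow> - l j) (at 0)" .
  show "l j = 0"
  proof (cases "j = 0")
    \<comment> \<open>With no coordinates left, the truncation is the constant
      \<open>g (\<lambda>_. 0) = 0\<close>, so this case is decided without the semigroup.\<close>
    case True
    hence "h x = 0" for x using g(2) by (simp add: h_def tr_def)
    hence "((\<lambda>t. h (\<phi> t) / t ^ W j) \<longlongrightarrow> 0) (at 0)" by simp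
    from tendsto_unique[OF at_neq_bot this hlim] show ?thesis by simp
  next
    case False
    have h: "h \<in> convergent_series j"
      using convergent_series_truncate[OF g(1), of j] by (simp add: h_def[abs_def] tr_def)
    have "(\<lambda>t. h (\<phi> t)) analytic_on {0}"
      by (rule convergent_series_compose_analytic[OF h]) (use \<phi>' jm in simp)
    hence "ord0 (\<lambda>t. h (\<phi> t)) = enat (W j)" if "l j \<noteq> 0"
      using ord0_eq_of_tendsto[OF _ hlim] that by simp
    hence "W j \<in> value_semigroup j \<phi>" if "l j \<noteq> 0"
      using h that unfolding value_semigroup_def by blast
    thus ?thesis using gap[of j] False jm by auto
  qed
qed

section \<open>Taylor polynomials and the resulting equivalence\<close>

lemma has_fps_expansion_jet:
  assumes "f has_fps_expansion F"
  shows "jet k f has_fps_expansion (\<Sum>j\<le>k. fps_const (fps_nth F j) * fps_X ^ j)"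
proof -
  have "(\<lambda>t. \<Sum>j\<le>k. fps_nth F j * t ^ j) has_fps_expansion (\<Sum>j\<le>k. fps_const (fps_nth F j) * fps_X ^ j)"
    by (intro has_fps_expansion_sum has_fps_expansion_mult has_fps_expansion_const has_fps_expansion_fps_X_power)
  moreover have "jet k f = (\<lambda>t. \<Sum>j\<le>k. fps_nth F j * t ^ j)"
    using fps_nth_fps_expansion[OF assms] by (simp add: jet_def fun_eq_iff)
  ultimately show ?thesis by simp
qed

lemma fps_nth_jet_remainder:
  fixes F :: "complex fps"
  assumes "j \<le> k"
  shows "fps_nth (F - (\<Sum>j\<le>k. fps_const (fps_nth F j) * fps_X ^ j)) j = 0"
proof -
  have "fps_nth (\<Sum>i\<le>k. fps_const (fps_nth F i) * fps_X ^ i) j = (\<Sum>i\<le>k. if i = j then fps_nth F j else 0)"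
    unfolding fps_sum_nth by (rule sum.cong) (auto simp: fps_X_power_nth)
  thus ?thesis using assms by simp
qed

lemma jet_power:
  assumes "\<forall>\<^sub>F t in nhds 0. f t = t ^ v" "v \<le> k"
  shows "jet k f = (\<lambda>t. t ^ v)"
proof
  fix t
  have f: "f has_fps_expansion fps_X ^ v"
    using has_fps_expansion_fps_X_power[of v] assms(1)
    by (subst has_fps_expansion_cong[of f "\<lambda>t. t ^ v"]) auto
  have "jet k f t = (\<Sum>j\<le>k. fps_nth (fps_X ^ v) j * t ^ j)"
    unfolding jet_def by (simp only: fps_nth_fps_expansion[OF f])
  also have "\<dots> = (\<Sum>j\<le>k. if j = v then t ^ v else 0)"
    by (rule sum.cong) (auto simp: fps_X_power_nth)
  finally show "jet k f t = t ^ v" using assms(2) by simp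
qed

text \<open>Points are functions on all natural numbers, and a curve germ at 0 vanishes only in its
  first \<open>m\<close> coordinates. Its value there need not be the zero function, although a
  convergent series cannot tell them apart.\<close>

lemma convergent_series_eq_at_origin:
  assumes "g \<in> convergent_series m" "\<And>i. i < m \<Longrightarrow> x i = 0"
  shows "g x = g (\<lambda>_. 0)"
proof -
  obtain R M a where R: "R > 0" and a: "series_bound m R M a g"
    using assms by (auto simp: convergent_series_iff_majorized majorized_def)
  have "((\<lambda>\<alpha>. a \<alpha> * mon m \<alpha> x) has_sum g x) (multi_indices m)"
    using a R assms(2) by (simp add: series_bound_def)
  moreover have "((\<lambda>\<alpha>. a \<alpha> * mon m \<alpha> (\<lambda>_. 0)) has_sum g (\<lambda>_. 0)) (multi_indices m)"
    using a R by (simp add: series_bound_def)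
  moreover have "mon m \<alpha> x = mon m \<alpha> (\<lambda>_. 0)" for \<alpha>
    unfolding mon_def by (rule prod.cong) (auto simp: assms(2))
  ultimately show ?thesis using has_sum_unique by fastforce
qed

text \<open>In \<open>Fc\<close>, vanishing below \<open>c\<close> makes the difference a pullback
  \<open>g i\<close>, and vanishing up to \<open>W i\<close> makes the linear part of
  \<open>g i\<close> strictly triangular. Setting \<open>W 0\<close> to the exponent of the first
  component puts all components on the same footing.\<close>

lemma A_equivalent_perturbation:
  assumes \<phi>: "curve_germ m \<phi>" and m: "0 < m"
    and \<phi>0: "\<forall>\<^sub>F t in nhds 0. \<phi> t 0 = t ^ W 0" and W0: "W 0 > 0"
    and W: "\<And>j k. j < k \<Longrightarrow> k < m \<Longrightarrow> W j < W k"
    and lead: "\<And>k. k < m \<Longrightarrow> ((\<lambda>t. \<phi> t k / t ^ W k) \<longlongrightarrow> 1) (at 0)"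
    and gap: "\<And>j. 0 < j \<Longrightarrow> j < m \<Longrightarrow> W j \<notin> value_semigroup j \<phi>"
    and \<Gamma>: "\<And>k. k \<ge> c \<Longrightarrow> k \<in> value_semigroup m \<phi>"
    and F: "\<And>i. i < m \<Longrightarrow> (\<lambda>t. \<phi> t i - \<psi> t i) has_fps_expansion F i"
    and Fc: "\<And>i j. i < m \<Longrightarrow> j < c \<or> j \<le> W i \<Longrightarrow> fps_nth (F i) j = 0"
  shows "A_equivalent m \<phi> \<psi>"
proof -
  have \<phi>': "(\<lambda>t. \<phi> t k) analytic_on {0} \<and> \<phi> 0 k = 0" if "k < m" for k
    using \<phi> that by (simp add: curve_germ_def)
  have "\<exists>g. g \<in> convergent_series m \<and> (\<forall>\<^sub>F t in nhds 0. g (\<phi> t) = \<phi> t i - \<psi> t i)" if i: "i < m" for i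
    by (rule pullback_surjective_above_conductor[OF \<phi> m W0 \<phi>0 \<Gamma> F[OF i]]) (use Fc[OF i] in auto)
  hence "\<forall>i. \<exists>g. i < m \<longrightarrow> g \<in> convergent_series m \<and> (\<forall>\<^sub>F t in nhds 0. g (\<phi> t) = \<phi> t i - \<psi> t i)"
    by blast
  from choice[OF this] obtain g where g: "\<And>i. i < m \<Longrightarrow> g i \<in> convergent_series m"
    and g\<phi>: "\<And>i. i < m \<Longrightarrow> \<forall>\<^sub>F t in nhds 0. g i (\<phi> t) = \<phi> t i - \<psi> t i"
    by blast
  have g0: "g i (\<lambda>_. 0) = 0" if i: "i < m" for i
  proof -
    have "g i (\<lambda>_. 0) = g i (\<phi> 0)"
      using convergent_series_eq_at_origin[OF g[OF i], of "\<phi> 0"] \<phi>' by simp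
    also have "\<dots> = \<phi> 0 i - \<psi> 0 i" using eventually_nhds_x_imp_x[OF g\<phi>[OF i]] .
    also have "\<dots> = 0"
      using has_fps_expansion_imp_0_eq_fps_nth_0[OF F[OF i]] Fc[OF i, of 0] by simp
    finally show ?thesis .
  qed
  have "\<exists>l. superlinear m (\<lambda>x. g i x - (\<Sum>k<m. l k * x k))" if i: "i < m" for i
  proof -
    obtain l where "superlinear m (\<lambda>x. g i x - g i (\<lambda>_. 0) - (\<Sum>k<m. l k * x k))"
      by (rule convergent_series_linear_part[OF g[OF i]])
    thus ?thesis by (intro exI[of _ l]) (simp add: g0[OF i])
  qed
  hence "\<forall>i. \<exists>l. i < m \<longrightarrow> superlinear m (\<lambda>x. g i x - (\<Sum>k<m. l k * x k))" by blast
  from choice[OF this] obtain l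
    where l: "\<And>i. i < m \<Longrightarrow> superlinear m (\<lambda>x. g i x - (\<Sum>k<m. l i k * x k))" by blast
  \<comment> \<open>The index 0 is included: even when the first component is unchanged,
    \<open>g 0\<close> is merely some series vanishing on the curve, and its linear part must be
    controlled as well.\<close>
  have "l i j = 0" if i: "i < m" and j: "j \<le> i" for i j
  proof (rule linear_part_triangular[OF \<phi> W0 W lead gap g[OF i] g0[OF i] l[OF i] i _ j])
    have "((\<lambda>t. (\<phi> t i - \<psi> t i) / t ^ W i) \<longlongrightarrow> fps_nth (F i) (W i)) (at 0)"
      by (rule fps_expansion_div_power_tendsto[OF F[OF i]]) (simp add: Fc[OF i])
    hence "((\<lambda>t. (\<phi> t i - \<psi> t i) / t ^ W i) \<longlongrightarrow> 0) (at 0)" using Fc[OF i, of "W i"] by simp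
    moreover have "\<forall>\<^sub>F t in at 0. (\<phi> t i - \<psi> t i) / t ^ W i = g i (\<phi> t) / t ^ W i"
      using g\<phi>[OF i] unfolding eventually_at_filter by eventually_elim simp
    ultimately show "((\<lambda>t. g i (\<phi> t) / t ^ W i) \<longlongrightarrow> 0) (at 0)"
      by (rule Lim_transform_eventually)
  qed
  from Diff_id_minus[OF g g0 l this] have "(\<lambda>x i. x i - g i x) \<in> Diff m" .
  moreover have "inverse_germs1 (\<lambda>t. t) (\<lambda>t. t)" by (simp add: inverse_germs1_def)
  moreover have "\<forall>\<^sub>F t in nhds 0. \<forall>i<m. \<psi> t i = \<phi> t i - g i (\<phi> t)"
  proof -
    have "\<forall>\<^sub>F t in nhds 0. \<forall>i\<in>{..<m}. g i (\<phi> t) = \<phi> t i - \<psi> t i"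
      by (rule eventually_ball_finite) (use g\<phi> in auto)
    thus ?thesis by eventually_elim auto
  qed
  ultimately show ?thesis
    unfolding A_equivalent_def
    by (intro exI[of _ "\<lambda>t. t"] exI[of _ "\<lambda>x i. x i - g i x"] conjI)
qed

text \<open>The degrees may exceed the minimal ones, so that both claims of the theorem are
  instances: one with individual degrees, one with their common maximum.\<close>

lemma A_equivalent_jets:
  assumes \<phi>: "\<phi> \<in> param_class n v\<^sub>0 w"
    and c: "is_conductor (value_semigroup (n + 1) \<phi>) c"
    and k: "\<And>i. i \<in> {1..n} \<Longrightarrow> max (w i) (c - 1) \<le> k i"
  shows "A_equivalent (n + 1) \<phi> (\<lambda>t i. if i = 0 then t ^ v\<^sub>0 else jet (k i) (\<lambda>s. \<phi> s i) t)"
proof -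
  define W where "W i = (if i = 0 then v\<^sub>0 else w i)" for i
  define \<psi> where "\<psi> t i = (if i = 0 then t ^ v\<^sub>0 else jet (k i) (\<lambda>s. \<phi> s i) t)" for t i
  have germ: "curve_germ (n + 1) \<phi>" and \<phi>0: "\<forall>\<^sub>F t in nhds 0. \<phi> t 0 = t ^ v\<^sub>0"
    and lead: "\<And>i. i \<in> {1..n} \<Longrightarrow> ord0 (\<lambda>t. \<phi> t i - t ^ w i) > enat (w i)"
    and gap: "\<And>i. i \<in> {1..n} \<Longrightarrow> w i \<notin> value_semigroup i \<phi>"
    and v: "v\<^sub>0 > 0" and vw: "\<And>i. i \<in> {1..n} \<Longrightarrow> v\<^sub>0 < w i" and w: "strict_mono_on {1..n} w"
    using \<phi> unfolding param_class_def parametrization_def is_min_def by simp_all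
  have ex: "(\<lambda>t. \<phi> t i) has_fps_expansion fps_expansion (\<lambda>t. \<phi> t i) 0" if "i < n + 1" for i
    using germ that by (intro analytic_at_imp_has_fps_expansion_0) (simp add: curve_germ_def)
  define P where "P i = fps_expansion (\<lambda>t. \<phi> t i) 0" for i
  define F where "F i = (if i = 0 then 0 else P i - (\<Sum>j\<le>k i. fps_const (fps_nth (P i) j) * fps_X ^ j))" for i
  have "A_equivalent (n + 1) \<phi> \<psi>"
  proof (rule A_equivalent_perturbation[OF germ, where W=W and c=c and F=F])
    show "W j < W i" if "j < i" "i < n + 1" for i j
      using that vw strict_mono_onD[OF w, of j i] by (auto simp: W_def)
    show "((\<lambda>t. \<phi> t i / t ^ W i) \<longlongrightarrow> 1) (at 0)" if i: "i < n + 1" for i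
    proof (cases "i = 0")
      case True
      have "\<forall>\<^sub>F t in at 0. 1 = \<phi> t i / t ^ W i"
        using \<phi>0 unfolding eventually_at_filter by eventually_elim (simp add: True W_def)
      thus ?thesis by (rule Lim_transform_eventually[OF tendsto_const])
    next
      case False
      hence i1: "i \<in> {1..n}" using i by auto
      have D: "(\<lambda>t. \<phi> t i - t ^ w i) has_fps_expansion P i - fps_X ^ w i"
        unfolding P_def by (intro has_fps_expansion_diff ex i has_fps_expansion_fps_X_power)
      have "fps_nth (P i - fps_X ^ w i) j = 0" if "j \<le> w i" for j
        by (rule ord0_fps_nth_eq_0[OF D lead[OF i1] that])
      with fps_expansion_div_power_tendsto[OF D, of "w i"]
      have "((\<lambda>t. (\<phi> t i - t ^ w i) / t ^ w i) \<longlongrightarrow> 0) (at 0)" by (simp del: fps_sub_nth)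
      hence "((\<lambda>t. (\<phi> t i - t ^ w i) / t ^ w i + 1) \<longlongrightarrow> 0 + 1) (at 0)"
        by (intro tendsto_add tendsto_const)
      moreover have "\<forall>\<^sub>F t in at 0. (\<phi> t i - t ^ w i) / t ^ w i + 1 = \<phi> t i / t ^ W i"
        unfolding eventually_at_filter
        by (intro always_eventually) (simp add: W_def False diff_divide_distrib)
      ultimately have "((\<lambda>t. \<phi> t i / t ^ W i) \<longlongrightarrow> 0 + 1) (at 0)" by (rule Lim_transform_eventually)
      thus ?thesis by simp
    qed
    show "W j \<notin> value_semigroup j \<phi>" if "0 < j" "j < n + 1" for j
      using gap[of j] that by (simp add: W_def)
    show "z \<in> value_semigroup (n + 1) \<phi>" if "z \<ge> c" for z
      using c that by (simp add: is_conductor_def)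
    show "(\<lambda>t. \<phi> t i - \<psi> t i) has_fps_expansion F i" if i: "i < n + 1" for i
    proof (cases "i = 0")
      case True
      have "\<forall>\<^sub>F t in nhds 0. \<phi> t i - \<psi> t i = 0"
        using \<phi>0 by eventually_elim (simp add: True \<psi>_def)
      thus ?thesis using True by (simp add: F_def has_fps_expansion_0_iff)
    next
      case False
      have "(\<lambda>t. \<phi> t i - jet (k i) (\<lambda>s. \<phi> s i) t) has_fps_expansion F i"
        unfolding F_def P_def using False
        by (simp, intro has_fps_expansion_diff ex i has_fps_expansion_jet[OF ex[OF i]])
      thus ?thesis using False by (simp add: \<psi>_def)
    qed
    show "fps_nth (F i) j = 0" if i: "i < n + 1" and j: "j < c \<or> j \<le> W i" for i j
    proof (cases "i = 0")
      case False
      \<comment> \<open>\<open>j < c\<close> forces \<open>c\<close> to be positive, so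
        \<open>j \<le> c - 1\<close> holds with truncated subtraction as well.\<close>
      hence "j \<le> k i" using k[of i] i j by (auto simp: W_def)
      from fps_nth_jet_remainder[OF this] show ?thesis
        unfolding F_def P_def using False by (simp only: if_False)
    qed (simp add: F_def)
  qed (use \<phi>0 v in \<open>simp_all add: W_def\<close>)
  thus ?thesis by (simp only: \<psi>_def[abs_def])
qed

theorem corollary5p4:
  fixes n v\<^sub>0 c :: nat and w e :: "nat \<Rightarrow> nat" and \<phi> :: "complex \<Rightarrow> nat \<Rightarrow> complex"
  assumes "n \<ge> 1"
    and "\<phi> \<in> param_class n v\<^sub>0 w"
    and "is_conductor (value_semigroup (n + 1) \<phi>) c"
    and "\<And>i. i \<in> {1..n} \<Longrightarrow> e i = max (w i) (c - 1)"
  shows "A_equivalent (n + 1) \<phi>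
           (\<lambda>t i. if i = 0 then t ^ v\<^sub>0 else jet (e i) (\<lambda>s. \<phi> s i) t)
       \<and> A_equivalent (n + 1) \<phi>
           (\<lambda>t i. jet (Max (e ` {1..n})) (\<lambda>s. \<phi> s i) t)"
proof
  show "A_equivalent (n + 1) \<phi> (\<lambda>t i. if i = 0 then t ^ v\<^sub>0 else jet (e i) (\<lambda>s. \<phi> s i) t)"
    by (rule A_equivalent_jets[OF assms(2,3)]) (simp add: assms(4))
  define K where "K = Max (e ` {1..n})"
  have K: "e i \<le> K" if "i \<in> {1..n}" for i using that by (auto simp: K_def)
  have \<phi>0: "\<forall>\<^sub>F t in nhds 0. \<phi> t 0 = t ^ v\<^sub>0" and "v\<^sub>0 < w 1"
    using assms(1,2) by (auto simp: param_class_def)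
  hence "v\<^sub>0 \<le> K" using K[of 1] assms(1) assms(4)[of 1] by simp
  \<comment> \<open>The common degree is at least \<open>w 1\<close>, which exceeds the exponent of
    the first component; the jet thus leaves that component untouched.\<close>
  from jet_power[OF \<phi>0 this]
  have "(\<lambda>t i. jet K (\<lambda>s. \<phi> s i) t) = (\<lambda>t i. if i = 0 then t ^ v\<^sub>0 else jet K (\<lambda>s. \<phi> s i) t)"
    by (intro ext) (simp split: if_split)
  moreover have "A_equivalent (n + 1) \<phi> (\<lambda>t i. if i = 0 then t ^ v\<^sub>0 else jet K (\<lambda>s. \<phi> s i) t)"
    by (rule A_equivalent_jets[OF assms(2,3)]) (use K assms(4) in \<open>simp add: max_def\<close>)
  ultimately show "A_equivalent (n + 1) \<phi> (\<lambda>t i. jet (Max (e ` {1..n})) (\<lambda>s. \<phi> s i) t)"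
    by (simp add: K_def)
qed

end
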